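(* Let $X=X_{\bar 0}\cup X_{\bar 1}$ be a $\mathbb{Z}_2$-graded set equipped with a well order. Then $(\mathbf{OLS}(X),\mathscr{P})$ (together with the inclusion $X\to\mathbf{OLS}(X)$) is a free operated Lie superalgebra on the $\mathbb{Z}_2$-graded set $X$, and the set $\mathbf{OSLSM}(X)$ of all operated super-Lyndon-Shirshov monomials is a linear basis of it.
   Context: $k$ is a field of characteristic zero. A $\mathbb{Z}_2$-graded set is a disjoint union $X=X_{\bar 0}\cup X_{\bar 1}$; $|x|=\bar i$ for $x\in X_{\bar i}$. $X$ is equipped with a well order $>_X$. For a set $Y$, $S(Y)$ is the free semigroup of nonempty words on $Y$. Operated superalgebras. An operated associative (resp. Lie) superalgebra is a pair $(A,P)$ with $A=A_{\bar 0}\oplus A_{\bar 1}$ an associative (resp. Lie) superalgebra over $k$ and $P:A\to A$ an even linear map. Homomorphisms are (even) superalgebra homomorphisms commuting with the operators; operated super-subalgebras are graded subalgebras stable under $P$. A free operated Lie superalgebra on $X$ is an operated Lie superalgebra $(F,P)$ with an even map $\mathbf{i}:X\to F$ such that for every operated Lie superalgebra $L$ and every even map $\mathbf{j}:X\to L$ there is a unique homomorphism $\phi:F\to L$ of operated Lie superalgebras with $\phi\mathbf{i}=\mathbf{j}$. Operated words. Put $\langle P;X;0\rangle=S(X)$, $\langle P;X;n\rangle=S(X\cup\{P(y):y\in\langle P;X;n-1\rangle\})$ (each $P(y)$ being a new formal letter) and $\langle P;X\rangle=\bigcup_n\langle P;X;n\rangle$. The parity $|w|$ of $w\in\langle P;X\rangle$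 is the sum of the parities of all occurrences of letters of $X$ in $w$. Elements of $X\cup\{P(y):y\in\langle P;X\rangle\}$ are called prime; every $u\in\langle P;X\rangle$ is uniquely $u=u_1\cdots u_n$ with $u_i$ prime, and $bre(u)=n$. $Deg(u)$ is the total number of occurrences of letters of $X$ and of $P$ in $u$. The order $>_{Dl}$ on $\langle P;X\rangle$: $u>_{Dl}v$ iff $(Deg(u),bre(u),u_1,\dots,u_n)>(Deg(v),bre(v),v_1,\dots,v_m)$ lexicographically, where primes of different $Deg$ are compared by $Deg$, letters of $X$ by $>_X$, and $P(\tilde u),P(\tilde v)$ of equal $Deg$ by comparing $\tilde u,\tilde v$ (inductively). $\mathbf{OAS}(X)=k\langle P;X\rangle$ with concatenation product, grading by parity, and operator $\mathscr{P}$, the linear extension of $w\mapsto P(w)$. It is an operated Lie superalgebra under $[u,v]=uv-(-1)^{|u||v|}vu$ ($u,v$ homogeneous). $\mathbf{OLS}(X)$ is the operated Lie super-subalgebra of $(\mathbf{OAS}(X),[\,,],\mathscr{P})$ generated by $X$. Super-Lyndon-Shirshov words. Let $Y$ be a $\mathbb{Z}_2$-graded well-ordered set. The lex order on words over $Y$ (including the empty word $1$): $1>_{lex}u$ for nonempty $u$; $y\tilde u>_{lex}y'\tilde v$ (with $y,y'\in Y$) iff $y>y'$, or $y=y'$ and $\tilde u>_{lex}\tilde v$. A nonempty word $u$ is an LS word if $u=vw>_{lex}wv$ for every factorization $u=vw$ into nonempty words. An SLS word is an LS word or a word $vv$ with $v$ an LS word and $|v|=\bar 1$. Each SLS word $u$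 has a canonical bracketing $[u]$, the SLS monomial: $[y]=y$ for $y\in Y$; $[u]=[[v][w]]$ for an LS word $u=vw$ of length $>1$, where $w$ is the longest proper suffix of $u$ that is an LS word; $[vv]=[[v][v]]$. Operated SLS words and monomials. Put $\mathfrak{X}^{(P,0)}=X$; let $\mathbf{OSLSW}(X,n)$ be the set of SLS words on the graded set $\mathfrak{X}^{(P,n)}$ ordered by the restriction of $>_{Dl}$, and $\mathfrak{X}^{(P,n+1)}=X\cup\{P(y):y\in\mathbf{OSLSW}(X,n)\}$. $\mathbf{OSLSW}(X)=\bigcup_n\mathbf{OSLSW}(X,n)$. The bracketing $[\,\cdot\,]$ on $\mathbf{OSLSW}(X)$ is defined recursively: $[x]=x$ for $x\in X$; $[P(w)]=P([w])$; and for $u=u_1\cdots u_m$ with $u_i\in\mathfrak{X}^{(P,n)}$, $[u]$ is the SLS monomial of the SLS word $[u_1][u_2]\cdots[u_m]$ in the letters $[u_i]$ (ordered as the $u_i$ are). $\mathbf{OSLSM}(X)=\{[w]:w\in\mathbf{OSLSW}(X)\}$; its elements are viewed in $\mathbf{OLS}(X)$ by interpreting brackets as the superbracket and $P$ as $\mathscr{P}$. *)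

theory Defs
  imports Complex_Main "HOL-Library.Poly_Mapping" "HOL-Library.Z2" "HOL-Library.FuncSet"
begin

section \<open>Operated Lie superalgebras\<close>

text \<open>Parities are elements of the field \<^typ>\<open>bit\<close> of integers mod 2. A graded vector space is a pair
  \<open>hom A 0\<close>, \<open>hom A 1\<close> of independent subspaces of an ambient vector space of class
  \<^class>\<open>ab_group_add\<close>; its underlying space is the (direct) sum \<open>carr A\<close>, which need
  not exhaust the ambient type. The product and the operator are only constrained on \<open>carr A\<close>.\<close>

record ('k, 'v) operated_superalg =
  scl :: "'k \<Rightarrow> 'v \<Rightarrow> 'v"
  hom :: "bit \<Rightarrow> 'v set"
  mul :: "'v \<Rightarrow> 'v \<Rightarrow> 'v"
  opr :: "'v \<Rightarrow> 'v"

definition carr :: "('k, 'v::ab_group_add, 'm) operated_superalg_scheme \<Rightarrow> 'v set" where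
  "carr A = {a + b | a b. a \<in> hom A 0 \<and> b \<in> hom A 1}"

text \<open>The sign \<open>(-1)^(i j)\<close>.\<close>

definition koszul :: "bit \<Rightarrow> bit \<Rightarrow> 'k::ring_1" where
  "koszul i j = (if i = 1 \<and> j = 1 then - 1 else 1)"

locale operated_Lie_superalgebra =
  vector_space "scl A" for A :: "('k::field, 'v::ab_group_add) operated_superalg" +
  assumes subspace_hom: "subspace (hom A i)"
    and hom_direct: "hom A 0 \<inter> hom A 1 = {0}"
    and mul_hom: "\<lbrakk>a \<in> hom A i; b \<in> hom A j\<rbrakk> \<Longrightarrow> mul A a b \<in> hom A (i + j)"
    and mul_add_left: "\<lbrakk>a \<in> carr A; a' \<in> carr A; b \<in> carr A\<rbrakk>
      \<Longrightarrow> mul A (a + a') b = mul A a b + mul A a' b"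
    and mul_add_right: "\<lbrakk>a \<in> carr A; b \<in> carr A; b' \<in> carr A\<rbrakk>
      \<Longrightarrow> mul A a (b + b') = mul A a b + mul A a b'"
    and mul_scl_left: "\<lbrakk>a \<in> carr A; b \<in> carr A\<rbrakk> \<Longrightarrow> mul A (scl A c a) b = scl A c (mul A a b)"
    and mul_scl_right: "\<lbrakk>a \<in> carr A; b \<in> carr A\<rbrakk> \<Longrightarrow> mul A a (scl A c b) = scl A c (mul A a b)"
    and skew: "\<lbrakk>a \<in> hom A i; b \<in> hom A j\<rbrakk> \<Longrightarrow> mul A a b = - scl A (koszul i j) (mul A b a)"
    and jacobi: "\<lbrakk>a \<in> hom A i; b \<in> hom A j; d \<in> hom A l\<rbrakk> \<Longrightarrow>
      mul A a (mul A b d) = mul A (mul A a b) d + scl A (koszul i j) (mul A b (mul A a d))"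
    and opr_hom: "a \<in> hom A i \<Longrightarrow> opr A a \<in> hom A i"
    and opr_add: "\<lbrakk>a \<in> carr A; b \<in> carr A\<rbrakk> \<Longrightarrow> opr A (a + b) = opr A a + opr A b"
    and opr_scl: "a \<in> carr A \<Longrightarrow> opr A (scl A c a) = scl A c (opr A a)"

definition operated_hom ::
  "('k, 'v::ab_group_add) operated_superalg \<Rightarrow> ('k, 'w::ab_group_add) operated_superalg
    \<Rightarrow> ('v \<Rightarrow> 'w) \<Rightarrow> bool" where
  "operated_hom A B \<phi> \<longleftrightarrow>
    (\<forall>i. \<forall>a\<in>hom A i. \<phi> a \<in> hom B i) \<and>
    (\<forall>a\<in>carr A. \<forall>b\<in>carr A. \<phi> (a + b) = \<phi> a + \<phi> b) \<and>
    (\<forall>c. \<forall>a\<in>carr A. \<phi> (scl A c a) = scl B c (\<phi> a)) \<and>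
    (\<forall>a\<in>carr A. \<forall>b\<in>carr A. \<phi> (mul A a b) = mul B (\<phi> a) (\<phi> b)) \<and>
    (\<forall>a\<in>carr A. \<phi> (opr A a) = opr B (\<phi> a))"

definition restrict_to ::
  "('k, 'v) operated_superalg \<Rightarrow> 'v set \<Rightarrow> ('k, 'v) operated_superalg" where
  "restrict_to A S = A\<lparr>hom := \<lambda>i. hom A i \<inter> S\<rparr>"

text \<open>The condition \<open>carr (restrict_to A S) = S\<close> says that \<open>S\<close> is the sum of its homogeneous parts.\<close>

definition operated_super_subalgebra ::
  "('k::field, 'v::ab_group_add) operated_superalg \<Rightarrow> 'v set \<Rightarrow> bool" where
  "operated_super_subalgebra A S \<longleftrightarrow>
    module.subspace (scl A) S \<and> carr (restrict_to A S) = S \<and>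
    (\<forall>a\<in>S. \<forall>b\<in>S. mul A a b \<in> S) \<and> (\<forall>a\<in>S. opr A a \<in> S)"

text \<open>A graded set is a set \<open>X\<close> with a parity function \<open>par\<close>. HOL cannot quantify over types inside
  a formula, so the type in which the test algebras \<open>L\<close> live is a parameter. Homomorphisms, being
  relevant only on the carrier, are taken extensional to make uniqueness meaningful.\<close>

definition even_map ::
  "'x set \<Rightarrow> ('x \<Rightarrow> bit) \<Rightarrow> ('k, 'v) operated_superalg \<Rightarrow> ('x \<Rightarrow> 'v) \<Rightarrow> bool" where
  "even_map X par A j \<longleftrightarrow> (\<forall>x\<in>X. j x \<in> hom A (par x))"

definition free_operated_Lie_superalgebra ::
  "'l::ab_group_add itself \<Rightarrow> 'x set \<Rightarrow> ('x \<Rightarrow> bit)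
    \<Rightarrow> ('k::field, 'v::ab_group_add) operated_superalg \<Rightarrow> ('x \<Rightarrow> 'v) \<Rightarrow> bool" where
  "free_operated_Lie_superalgebra (_ :: 'l itself) X par F \<iota> \<longleftrightarrow>
    operated_Lie_superalgebra F \<and> even_map X par F \<iota> \<and>
    (\<forall>(L :: ('k, 'l) operated_superalg) j.
      operated_Lie_superalgebra L \<and> even_map X par L j \<longrightarrow>
      (\<exists>!\<phi>. \<phi> \<in> extensional (carr F) \<and> operated_hom F L \<phi> \<and> (\<forall>x\<in>X. \<phi> (\<iota> x) = j x)))"

definition linear_basis_of ::
  "('k::field \<Rightarrow> 'v::ab_group_add \<Rightarrow> 'v) \<Rightarrow> 'v set \<Rightarrow> 'v set \<Rightarrow> bool" where
  "linear_basis_of s V B \<longleftrightarrow> \<not> module.dependent s B \<and> module.span s B = V"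


section \<open>Operated words\<close>

text \<open>Words are lists of primes. The types also contain the empty word (also below \<open>OpLetter\<close>);
  \<open>operated_words X\<close> excludes it.\<close>

datatype 'x oprime = Letter 'x | OpLetter "'x oprime list"

primrec operated_words_upto :: "'x set \<Rightarrow> nat \<Rightarrow> 'x oprime list set" where
  "operated_words_upto X 0 = lists (Letter ` X) - {[]}"
| "operated_words_upto X (Suc n) =
    lists (Letter ` X \<union> OpLetter ` operated_words_upto X n) - {[]}"

definition operated_words :: "'x set \<Rightarrow> 'x oprime list set" where
  "operated_words X = (\<Union>n. operated_words_upto X n)"

fun prime_parity :: "('x \<Rightarrow> bit) \<Rightarrow> 'x oprime \<Rightarrow> bit" where
  "prime_parity par (Letter x) = par x"
| "prime_parity par (OpLetter w) = sum_list (map (prime_parity par) w)"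

definition word_parity :: "('y \<Rightarrow> bit) \<Rightarrow> 'y list \<Rightarrow> bit" where
  "word_parity par w = sum_list (map par w)"

abbreviation oword_parity :: "('x \<Rightarrow> bit) \<Rightarrow> 'x oprime list \<Rightarrow> bit" where
  "oword_parity par \<equiv> word_parity (prime_parity par)"

fun prime_Deg :: "'x oprime \<Rightarrow> nat" where
  "prime_Deg (Letter x) = 1"
| "prime_Deg (OpLetter w) = 1 + sum_list (map prime_Deg w)"

definition Deg :: "'x oprime list \<Rightarrow> nat" where
  "Deg w = sum_list (map prime_Deg w)"

text \<open>The lexicographic order on words over letters ordered by \<open>gt\<close>; note that a proper prefix is
  greater than its extensions.\<close>

fun lex_gt :: "('y \<Rightarrow> 'y \<Rightarrow> bool) \<Rightarrow> 'y list \<Rightarrow> 'y list \<Rightarrow> bool" where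
  "lex_gt gt u [] = False"
| "lex_gt gt [] (y # v) = True"
| "lex_gt gt (y # u) (y' # v) = (gt y y' \<or> y = y' \<and> lex_gt gt u v)"

lemma lex_gt_cong [fundef_cong]:
  assumes "u = u'" "v = v'" "\<And>y z. y \<in> set u' \<Longrightarrow> z \<in> set v' \<Longrightarrow> gt y z = gt' y z"
  shows "lex_gt gt u v = lex_gt gt' u' v'"
proof -
  have "lex_gt gt u v = lex_gt gt' u v" if "\<And>y z. y \<in> set u \<Longrightarrow> z \<in> set v \<Longrightarrow> gt y z = gt' y z"
    using that by (induction gt u v rule: lex_gt.induct) auto
  with assms show ?thesis by blast
qed

text \<open>The order \<open>>\<^sub>D\<^sub>l\<close> on primes and on words; \<open>(x, y) \<in> r\<close> means \<open>x \<le> y\<close> for letters. A letter of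
  \<open>X\<close> and a prime \<open>P(u)\<close> never have the same degree. On words of the same breadth, \<^const>\<open>lex_gt\<close> is
  the ordinary lexicographic comparison of \<open>(u\<^sub>1, \<dots>, u\<^sub>n)\<close> and \<open>(v\<^sub>1, \<dots>, v\<^sub>n)\<close>.\<close>

fun prime_gt :: "'x rel \<Rightarrow> 'x oprime \<Rightarrow> 'x oprime \<Rightarrow> bool"
  and Dl_gt :: "'x rel \<Rightarrow> 'x oprime list \<Rightarrow> 'x oprime list \<Rightarrow> bool" where
  "prime_gt r p q =
    (prime_Deg p > prime_Deg q \<or> prime_Deg p = prime_Deg q \<and>
      (case (p, q) of
        (Letter x, Letter y) \<Rightarrow> x \<noteq> y \<and> (y, x) \<in> r
      | (OpLetter u, OpLetter v) \<Rightarrow> Dl_gt r u v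
      | _ \<Rightarrow> False))"
| "Dl_gt r u v =
    (Deg u > Deg v \<or> Deg u = Deg v \<and>
      (length u > length v \<or> length u = length v \<and> lex_gt (\<lambda>p q. prime_gt r p q) u v))"

declare prime_gt.simps [simp del] Dl_gt.simps [simp del]


section \<open>The operated superalgebras \<open>OAS(X)\<close> and \<open>OLS(X)\<close>\<close>

text \<open>\<open>OAS(X)\<close> consists of the finitely supported functions with support in \<open>operated_words X\<close>.\<close>

type_synonym ('x, 'k) oas = "'x oprime list \<Rightarrow>\<^sub>0 'k"

definition oas_scale :: "'k::field \<Rightarrow> ('x, 'k) oas \<Rightarrow> ('x, 'k) oas" where
  "oas_scale c f = Poly_Mapping.map (\<lambda>a. c * a) f"

definition oas_mult :: "('x, 'k::field) oas \<Rightarrow> ('x, 'k) oas \<Rightarrow> ('x, 'k) oas" where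
  "oas_mult f g = (\<Sum>u\<in>Poly_Mapping.keys f. \<Sum>v\<in>Poly_Mapping.keys g.
    Poly_Mapping.single (u @ v) (Poly_Mapping.lookup f u * Poly_Mapping.lookup g v))"

definition oas_op :: "('x, 'k::field) oas \<Rightarrow> ('x, 'k) oas" where
  "oas_op f = (\<Sum>w\<in>Poly_Mapping.keys f. Poly_Mapping.single [OpLetter w] (Poly_Mapping.lookup f w))"

definition oas_component :: "('x \<Rightarrow> bit) \<Rightarrow> bit \<Rightarrow> ('x, 'k::field) oas \<Rightarrow> ('x, 'k) oas" where
  "oas_component par i f = (\<Sum>w | w \<in> Poly_Mapping.keys f \<and> oword_parity par w = i.
    Poly_Mapping.single w (Poly_Mapping.lookup f w))"

text \<open>The superbracket \<open>[f, g] = f g - (-1)^(|f||g|) g f\<close> of homogeneous elements, extended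
  biadditively through the decomposition into homogeneous components.\<close>

definition oas_bracket ::
  "('x \<Rightarrow> bit) \<Rightarrow> ('x, 'k::field) oas \<Rightarrow> ('x, 'k) oas \<Rightarrow> ('x, 'k) oas" where
  "oas_bracket par f g = (\<Sum>i\<in>{0, 1}. \<Sum>j\<in>{0, 1}.
    oas_mult (oas_component par i f) (oas_component par j g)
      - oas_scale (koszul i j) (oas_mult (oas_component par j g) (oas_component par i f)))"

definition OAS_Lie ::
  "'x set \<Rightarrow> ('x \<Rightarrow> bit) \<Rightarrow> ('k::field, ('x, 'k) oas) operated_superalg" where
  "OAS_Lie X par =
    \<lparr>scl = oas_scale,
     hom = \<lambda>i. {f. \<forall>w\<in>Poly_Mapping.keys f. w \<in> operated_words X \<and> oword_parity par w = i},
     mul = oas_bracket par,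
     opr = oas_op\<rparr>"

definition oas_gen :: "'x \<Rightarrow> ('x, 'k::field) oas" where
  "oas_gen x = Poly_Mapping.single [Letter x] 1"

definition OLS ::
  "'x set \<Rightarrow> ('x \<Rightarrow> bit) \<Rightarrow> ('k::field, ('x, 'k) oas) operated_superalg" where
  "OLS X par = restrict_to (OAS_Lie X par)
    (operated_super_subalgebra (OAS_Lie X par) hull (oas_gen ` X))"


section \<open>Super-Lyndon-Shirshov words and monomials\<close>

definition LS_word :: "('y \<Rightarrow> 'y \<Rightarrow> bool) \<Rightarrow> 'y list \<Rightarrow> bool" where
  "LS_word gt u \<longleftrightarrow> u \<noteq> [] \<and>
    (\<forall>v w. v \<noteq> [] \<and> w \<noteq> [] \<and> u = v @ w \<longrightarrow> lex_gt gt u (w @ v))"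

definition SLS_words :: "('y \<Rightarrow> 'y \<Rightarrow> bool) \<Rightarrow> ('y \<Rightarrow> bit) \<Rightarrow> 'y set \<Rightarrow> 'y list set" where
  "SLS_words gt par Y =
    {u \<in> lists Y. LS_word gt u \<or> (\<exists>v. LS_word gt v \<and> word_parity par v = 1 \<and> u = v @ v)}"

text \<open>Nonassociative words over \<open>'y\<close>.\<close>

datatype 'y magma = Gen 'y | Br "'y magma" "'y magma"

text \<open>The canonical bracketing of an SLS word (arbitrary on other words). The longest proper suffix
  of \<open>u\<close> that is an LS word is \<open>drop k u\<close> for the least positive such \<open>k\<close>. An SLS word of length
  greater than one that is not an LS word is a square \<open>v v\<close>.\<close>

definition LS_split :: "('y \<Rightarrow> 'y \<Rightarrow> bool) \<Rightarrow> 'y list \<Rightarrow> nat" where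
  "LS_split gt u = (LEAST k. 0 < k \<and> LS_word gt (drop k u))"

lemma LS_word_single [simp]: "LS_word gt [y]"
  by (auto simp: LS_word_def Cons_eq_append_conv)

lemma LS_split_bounds:
  assumes "1 < length u"
  shows "0 < LS_split gt u" "LS_split gt u < length u" "LS_word gt (drop (LS_split gt u) u)"
proof -
  have "drop (length u - 1) u = [last u]"
    using assms by (metis append_butlast_last_id append_eq_conv_conj length_butlast
        list.size(3) not_less_zero)
  then have "0 < length u - 1 \<and> LS_word gt (drop (length u - 1) u)"
    using assms by simp
  then have *: "0 < LS_split gt u \<and> LS_word gt (drop (LS_split gt u) u)"
    unfolding LS_split_def by (rule LeastI)
  then show "0 < LS_split gt u" "LS_word gt (drop (LS_split gt u) u)" by auto
  with * show "LS_split gt u < length u"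
    by (metis LS_word_def drop_all linorder_not_less)
qed

function SLS_monomial :: "('y \<Rightarrow> 'y \<Rightarrow> bool) \<Rightarrow> 'y list \<Rightarrow> 'y magma" where
  "SLS_monomial gt u =
    (if length u \<le> 1 then Gen (hd u)
     else let k = (if LS_word gt u then LS_split gt u else length u div 2)
       in Br (SLS_monomial gt (take k u)) (SLS_monomial gt (drop k u)))"
  by pat_completeness auto
termination
proof (relation "measure (\<lambda>(gt, u). length u)", goal_cases)
  case (2 gt u k)
  then show ?case using LS_split_bounds[of u gt] by (auto split: if_splits)
next
  case (3 gt u k)
  then show ?case using LS_split_bounds[of u gt] by (auto split: if_splits)
qed auto

declare SLS_monomial.simps [simp del]

lemma set_SLS_monomial:
  "u \<noteq> [] \<Longrightarrow> set_magma (SLS_monomial gt u) \<subseteq> set u"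
proof (induction gt u rule: SLS_monomial.induct)
  case (1 gt u)
  define k where "k = (if LS_word gt u then LS_split gt u else length u div 2)"
  show ?case
  proof (cases "length u \<le> 1")
    case True
    with 1 show ?thesis by (simp add: SLS_monomial.simps)
  next
    case False
    then have "0 < k" "k < length u"
      using LS_split_bounds[of u gt] by (auto simp: k_def)
    then have "set_magma (SLS_monomial gt (take k u)) \<subseteq> set (take k u)"
        "set_magma (SLS_monomial gt (drop k u)) \<subseteq> set (drop k u)"
      using 1(1,2)[OF False k_def] 1(3) by auto
    then show ?thesis
      using False set_take_subset[of k u] set_drop_subset[of k u]
      by (subst SLS_monomial.simps) (auto simp: Let_def k_def[symmetric])
  qed
qed


section \<open>Operated super-Lyndon-Shirshov words and monomials\<close>

primrec OSLS_letters :: "'x rel \<Rightarrow> ('x \<Rightarrow> bit) \<Rightarrow> 'x set \<Rightarrow> nat \<Rightarrow> 'x oprime set" where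
  "OSLS_letters r par X 0 = Letter ` X"
| "OSLS_letters r par X (Suc n) = Letter ` X \<union>
    OpLetter ` SLS_words (prime_gt r) (prime_parity par) (OSLS_letters r par X n)"

definition OSLSW_upto :: "'x rel \<Rightarrow> ('x \<Rightarrow> bit) \<Rightarrow> 'x set \<Rightarrow> nat \<Rightarrow> 'x oprime list set" where
  "OSLSW_upto r par X n = SLS_words (prime_gt r) (prime_parity par) (OSLS_letters r par X n)"

definition OSLSW :: "'x rel \<Rightarrow> ('x \<Rightarrow> bit) \<Rightarrow> 'x set \<Rightarrow> 'x oprime list set" where
  "OSLSW r par X = (\<Union>n. OSLSW_upto r par X n)"

text \<open>Formal operated nonassociative monomials; \<open>graft\<close> turns a bracketing of monomials into a
  single monomial.\<close>

datatype 'x omonomial = MLetter 'x | MOp "'x omonomial" | MBr "'x omonomial" "'x omonomial"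

primrec graft :: "'x omonomial magma \<Rightarrow> 'x omonomial" where
  "graft (Gen m) = m"
| "graft (Br s t) = MBr (graft s) (graft t)"

text \<open>The bracketing of an operated word \<open>u\<^sub>1 \<dots> u\<^sub>m\<close>: the letters \<open>[u\<^sub>i]\<close> are ordered as the \<open>u\<^sub>i\<close>
  are, so the SLS monomial in the \<open>[u\<^sub>i]\<close> is obtained from the one in the \<open>u\<^sub>i\<close> by replacing each
  \<open>u\<^sub>i\<close> by \<open>[u\<^sub>i]\<close>. Its value on the empty word is irrelevant.\<close>

function (sequential) prime_bracketing :: "'x rel \<Rightarrow> 'x oprime \<Rightarrow> 'x omonomial"
  and bracketing :: "'x rel \<Rightarrow> 'x oprime list \<Rightarrow> 'x omonomial" where
  "prime_bracketing r (Letter x) = MLetter x"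
| "prime_bracketing r (OpLetter w) = MOp (bracketing r w)"
| "bracketing r u = (if u = [] then undefined
     else graft (map_magma (\<lambda>p. prime_bracketing r p) (SLS_monomial (prime_gt r) u)))"
  by pat_completeness auto
termination
proof (relation "measure (case_sum (\<lambda>(r, p). size p) (\<lambda>(r, u). size_list size u))", goal_cases)
  case (3 r u p)
  then have "p \<in> set u" using set_SLS_monomial by blast
  then show ?case by (induction u) auto
qed auto

declare bracketing.simps [simp del]

definition OSLSM :: "'x rel \<Rightarrow> ('x \<Rightarrow> bit) \<Rightarrow> 'x set \<Rightarrow> 'x omonomial set" where
  "OSLSM r par X = bracketing r ` OSLSW r par X"

primrec interp :: "('x \<Rightarrow> bit) \<Rightarrow> 'x omonomial \<Rightarrow> ('x, 'k::field) oas" where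
  "interp par (MLetter x) = oas_gen x"
| "interp par (MOp m) = oas_op (interp par m)"
| "interp par (MBr s t) = oas_bracket par (interp par s) (interp par t)"

end

theory Submission
  imports Defs "HOL-Library.Product_Plus"
begin

text \<open>Throughout, \<open>u \<prec> v\<close> stands for \<open>lex_gt gt u v\<close>. Read with the letter order reversed, this is the usual
lexicographic order, in which a proper prefix comes first, and the LS words are exactly the Lyndon
words for it.

\<^bold>\<open>Spanning.\<close> Let \<open>A\<close> be any operated Lie superalgebra with an even map \<open>X \<rightarrow> A\<close>. The values in \<open>A\<close> of
the operated SLS monomials span a subspace closed under the operator and under the bracket
(\<open>OSLSM_span_opr\<close>, \<open>OSLSM_span_mul\<close>). Closure under the operator is clear, since \<open>P(w)\<close> is an operated
SLS word of breadth one. For the bracket, let \<open>u \<prec> v\<close> be LS words. Either \<open>(u, v)\<close> is the standard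
factorization of \<open>uv\<close>, so that \<open>[[u],[v]] = [uv]\<close>, or \<open>u\<close> has a standard factorization \<open>u = u'u''\<close> with
\<open>u'' \<prec> v\<close>, and the Jacobi identity leads to \<open>[[u'],[[u''],[v]]]\<close> and \<open>[[u''],[[u'],[v]]]\<close>. The inner
brackets are shorter, so inductively they are combinations of monomials with roots below \<open>v\<close> (the root
of \<open>z\<close> and of \<open>zz\<close> is \<open>z\<close>); then the outer brackets only involve roots below \<open>v\<close>. Hence induction on
the total length and then on the larger root works (\<open>rewritable_step\<close>). Squares of odd elements are
handled by \<open>[[z,z],d] = 2[z,[z,d]]\<close> and \<open>[z,[z,z]] = 0\<close>.

\<^bold>\<open>Independence.\<close> In \<open>OAS(X)\<close> the monomial \<open>[u]\<close> is a nonzero multiple of \<open>u\<close> (the factor is a power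
of two) plus words smaller than \<open>u\<close> in the order \<open>>\<^sub>D\<^sub>l\<close> (\<open>leading_interp\<close>). So the monomials are
pairwise distinct and linearly independent, and together with the first part they form a basis of
\<open>OLS(X)\<close>.

\<^bold>\<open>Freeness.\<close> Given \<open>j : X \<rightarrow> L\<close>, spanning is applied to the product algebra \<open>OAS(X) \<times> L\<close> and the map
\<open>x \<mapsto> (x, j x)\<close>: the span \<open>G\<close> of the pairs formed by the values of each monomial in \<open>OAS(X)\<close> and in \<open>L\<close> is
an operated subalgebra. By independence the projection of \<open>G\<close> to \<open>OAS(X)\<close> is injective, and its image is
\<open>OLS(X)\<close>. So \<open>G\<close> is the graph of a map \<open>OLS(X) \<rightarrow> L\<close>, and being a subalgebra it is the graph of a
homomorphism. In this way no structure constants have to be compared. Uniqueness holds because \<open>X\<close>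
generates \<open>OLS(X)\<close>.\<close>

section \<open>Lyndon-Shirshov words\<close>

lemma lex_gt_irrefl: "(\<And>y. y \<in> set u \<Longrightarrow> \<not> gt y y) \<Longrightarrow> \<not> lex_gt gt u u"
  by (induction u) auto

lemma lex_gt_trans:
  "(\<And>y z t. y \<in> set u \<Longrightarrow> gt y z \<Longrightarrow> gt z t \<Longrightarrow> gt y t) \<Longrightarrow>
    lex_gt gt u v \<Longrightarrow> lex_gt gt v w \<Longrightarrow> lex_gt gt u w"
proof (induction u arbitrary: v w)
  case Nil
  then show ?case by (cases v; cases w) auto
next
  case (Cons a u)
  have IH: "lex_gt gt u v \<Longrightarrow> lex_gt gt v w \<Longrightarrow> lex_gt gt u w" for v w
    by (rule Cons.IH[of v w]) (use Cons.prems(1) in auto)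
  have tr: "gt a y \<Longrightarrow> gt y t \<Longrightarrow> gt a t" for y t
    by (rule Cons.prems(1)[of a y t]) simp_all
  show ?case using Cons.prems(2,3) by (cases v; cases w) (auto intro: tr IH)
qed

lemma lex_gt_total:
  "(\<And>y z. y \<in> set u \<Longrightarrow> z \<in> set v \<Longrightarrow> y \<noteq> z \<Longrightarrow> gt y z \<or> gt z y) \<Longrightarrow>
    u \<noteq> v \<Longrightarrow> lex_gt gt u v \<or> lex_gt gt v u"
proof (induction u arbitrary: v)
  case Nil
  then show ?case by (cases v) auto
next
  case (Cons a u)
  show ?case
  proof (cases v)
    case (Cons c v')
    moreover have "u \<noteq> v' \<Longrightarrow> lex_gt gt u v' \<or> lex_gt gt v' u"
      by (rule Cons.IH) (use Cons.prems(1) Cons in auto)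
    ultimately show ?thesis using Cons.prems by auto
  qed auto
qed

text \<open>Totality is required on \<open>Y\<close> only, because the order on primes is total on the operated words over \<open>X\<close>
but not on the whole type.\<close>

locale alphabet =
  fixes gt :: "'y \<Rightarrow> 'y \<Rightarrow> bool" and Y :: "'y set"
  assumes gt_irrefl: "\<not> gt y y"
    and gt_trans: "gt y z \<Longrightarrow> gt z t \<Longrightarrow> gt y t"
    and gt_total: "y \<in> Y \<Longrightarrow> z \<in> Y \<Longrightarrow> y \<noteq> z \<Longrightarrow> gt y z \<or> gt z y"
begin

abbreviation lex_less (infix "\<prec>" 50) where "u \<prec> v \<equiv> lex_gt gt u v"

lemma Nil_less [simp]: "[] \<prec> v \<longleftrightarrow> v \<noteq> []"
  by (cases v) auto

lemma less_irrefl [simp]: "\<not> u \<prec> u"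
  by (rule lex_gt_irrefl) (rule gt_irrefl)

lemma less_trans: "u \<prec> v \<Longrightarrow> v \<prec> w \<Longrightarrow> u \<prec> w"
  by (rule lex_gt_trans[of u gt v w]) (blast intro: gt_trans)+

lemma less_total: "u \<in> lists Y \<Longrightarrow> v \<in> lists Y \<Longrightarrow> u \<noteq> v \<Longrightarrow> u \<prec> v \<or> v \<prec> u"
  by (rule lex_gt_total) (use gt_total in auto)

lemma less_append [simp]: "u \<prec> u @ v \<longleftrightarrow> v \<noteq> []"
  by (induction u) (auto simp: gt_irrefl)

lemma append_less_cancel [simp]: "u @ v \<prec> u @ w \<longleftrightarrow> v \<prec> w"
  by (induction u) (auto simp: gt_irrefl)

text \<open>A word that precedes another one without being a prefix of it does so because of a letter, and then
arbitrary continuations do not change the comparison.\<close>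

lemma less_append_append:
  "u \<prec> v \<Longrightarrow> (\<And>t. v \<noteq> u @ t) \<Longrightarrow> u @ x \<prec> v @ y"
proof (induction u arbitrary: v)
  case (Cons a u)
  then obtain c v' where v: "v = c # v'" by (cases v) auto
  with Cons.prems(2) have "a = c \<Longrightarrow> v' \<noteq> u @ t" for t by auto
  with Cons v show ?case by auto
qed auto

lemma less_append_append_length:
  "u \<prec> v \<Longrightarrow> length v \<le> length u \<Longrightarrow> u @ x \<prec> v @ y"
  by (rule less_append_append) auto

text \<open>Together with \<open>LS_word_less_suffix\<close>, this describes LS words by their suffixes instead of their
rotations, which is the form that the arguments below use.\<close>

lemma LS_wordI:
  assumes "u \<noteq> []" "\<And>v w. u = v @ w \<Longrightarrow> v \<noteq> [] \<Longrightarrow> w \<noteq> [] \<Longrightarrow> u \<prec> w"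
  shows "LS_word gt u"
  unfolding LS_word_def using assms less_append less_trans by blast

text \<open>A proper suffix \<open>w\<close> that precedes \<open>u\<close> would have to be a prefix of \<open>u\<close>, as otherwise the rotation starting
with \<open>w\<close> precedes \<open>u\<close>. If \<open>u = vw = wt\<close>, then \<open>u \<prec> wv\<close> forces \<open>t \<prec> v\<close>, and \<open>u \<prec> tw\<close> contradicts this.\<close>

lemma LS_word_less_suffix:
  assumes u: "LS_word gt u" "u \<in> lists Y" and vw: "u = v @ w" "v \<noteq> []" "w \<noteq> []"
  shows "u \<prec> w"
proof (rule ccontr)
  assume "\<not> u \<prec> w"
  moreover have "w \<in> lists Y" "u \<noteq> w" using u vw by auto
  ultimately have wu: "w \<prec> u" using less_total u(2) by blast
  have uwv: "u \<prec> w @ v" using u(1) vw by (auto simp: LS_word_def)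
  show False
  proof (cases "\<exists>t. u = w @ t")
    case False
    then have "w @ v \<prec> u @ []" using wu by (intro less_append_append) auto
    with uwv show False using less_trans less_irrefl by fastforce
  next
    case True
    then obtain t where t: "u = w @ t" by blast
    then have tv: "t \<prec> v" using uwv by simp
    have len: "length t = length v" using arg_cong[OF t, of length] arg_cong[OF vw(1), of length] by simp
    have "t \<noteq> []" using vw(2) len by (metis length_0_conv)
    then have "u \<prec> t @ w" using u(1)[unfolded LS_word_def, THEN conjunct2, rule_format, of w t] t vw(3) by metis
    moreover have "t @ w \<prec> v @ w"
      using tv len by (intro less_append_append_length) auto
    ultimately show False using vw(1) less_trans less_irrefl by blast
  qed
qed

text \<open>First \<open>uv \<prec> v\<close>: this is clear unless \<open>v = ut\<close>, and then \<open>v \<prec> t\<close> because \<open>v\<close> is an LS word. A suffix of \<open>v\<close>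
comes after \<open>v\<close>, and a longer suffix \<open>sv\<close> comes after \<open>uv\<close> because \<open>u \<prec> s\<close> and \<open>s\<close> is shorter than \<open>u\<close>.\<close>

lemma LS_word_append:
  assumes u: "LS_word gt u" "u \<in> lists Y" and v: "LS_word gt v" "v \<in> lists Y" and uv: "u \<prec> v"
  shows "LS_word gt (u @ v)"
proof (rule LS_wordI)
  show "u @ v \<noteq> []" using u(1) by (auto simp: LS_word_def)
  have uvv: "u @ v \<prec> v"
  proof (cases "\<exists>t. v = u @ t")
    case True
    then obtain t where t: "v = u @ t" by blast
    moreover have "t \<noteq> []" using t uv by auto
    moreover have "u \<noteq> []" using u(1) by (auto simp: LS_word_def)
    ultimately have "v \<prec> t" using LS_word_less_suffix v by blast
    then have "u @ v \<prec> u @ t" by simp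
    then show ?thesis using t by simp
  next
    case False
    then show ?thesis using less_append_append[OF uv, of v "[]"] by auto
  qed
  fix x w assume xw: "u @ v = x @ w" "x \<noteq> []" "w \<noteq> []"
  then consider s where "u = x @ s" "w = s @ v" | s where "x = u @ s" "v = s @ w"
    by (auto simp: append_eq_append_conv2)
  then show "u @ v \<prec> w"
  proof cases
    case (1 s)
    show ?thesis
    proof (cases "s = []")
      case False
      then have "u \<prec> s" using LS_word_less_suffix[OF u 1(1)] xw by auto
      then have "u @ v \<prec> s @ v" using 1 by (intro less_append_append_length) auto
      then show ?thesis using 1 by simp
    qed (use 1 uvv in auto)
  next
    case (2 s)
    show ?thesis
    proof (cases "s = []")
      case False
      then have "v \<prec> w" using LS_word_less_suffix[OF v 2(2)] xw by auto
      then show ?thesis using uvv less_trans by blast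
    qed (use 2 uvv in auto)
  qed
qed

lemma finite_has_least:
  "finite S \<Longrightarrow> S \<noteq> {} \<Longrightarrow> S \<subseteq> lists Y \<Longrightarrow> \<exists>m\<in>S. \<forall>s\<in>S. s \<noteq> m \<longrightarrow> m \<prec> s"
proof (induction rule: finite_ne_induct)
  case (insert x F)
  then obtain m where m: "m \<in> F" "\<forall>s\<in>F. s \<noteq> m \<longrightarrow> m \<prec> s" by auto
  have "x \<noteq> m" using m insert by auto
  then consider "x \<prec> m" | "m \<prec> x" using less_total[of x m] insert m by auto
  then show ?case
  proof cases
    case 1
    then have "\<forall>s\<in>insert x F. s \<noteq> x \<longrightarrow> x \<prec> s" using m less_trans by (metis insert_iff)
    then show ?thesis by blast
  next
    case 2
    then show ?thesis using m by blast
  qed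
qed auto

text \<open>The least proper suffix is an LS word, since it precedes its own suffixes. A longer proper suffix cannot
be an LS word, because it would precede the least one. So the longest LS suffix, which is what
\<^const>\<open>LS_split\<close> finds, is the least one.\<close>

lemma drop_LS_split_least:
  assumes u: "u \<in> lists Y" "1 < length u" and k: "0 < k" "k < length u" "k \<noteq> LS_split gt u"
  shows "drop (LS_split gt u) u \<prec> drop k u"
proof -
  let ?S = "(\<lambda>k. drop k u) ` {0<..<length u}"
  have "drop k u \<in> ?S" by (rule imageI) (use k in simp)
  then have ne: "?S \<noteq> {}" by (metis empty_iff)
  have sub: "?S \<subseteq> lists Y" using u(1) by (auto dest: in_set_dropD)
  obtain m where "m \<in> ?S" and m: "\<forall>s\<in>?S. s \<noteq> m \<longrightarrow> m \<prec> s"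
    using finite_has_least[OF _ ne sub] by auto
  then obtain l where l: "m = drop l u" "0 < l" "l < length u" by auto
  have lm: "m \<prec> drop i u" if "0 < i" "i < length u" "i \<noteq> l" for i
  proof -
    have "drop i u \<noteq> m" using that l by (metis diff_diff_cancel length_drop less_or_eq_imp_le)
    then show ?thesis using m that by auto
  qed
  have "LS_word gt m"
  proof (rule LS_wordI)
    show "m \<noteq> []" using l by auto
    fix v w assume vw: "m = v @ w" "v \<noteq> []" "w \<noteq> []"
    then have "w = drop (l + length v) u" using l by (metis add.commute append_eq_conv_conj drop_drop)
    moreover from this have "l + length v < length u"
      using vw(3) by (metis drop_all not_le)
    ultimately show "m \<prec> w" using lm[of "l + length v"] vw l by auto
  qed
  moreover have "\<not> LS_word gt (drop i u)" if "0 < i" "i < l" for i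
  proof
    assume "LS_word gt (drop i u)"
    moreover have "drop i u = take (l - i) (drop i u) @ m"
      using l that by (metis append_take_drop_id drop_drop le_add_diff_inverse2 less_imp_le_nat)
    moreover have "drop i u \<in> lists Y" using u(1) by (auto dest: in_set_dropD)
    moreover have "m \<noteq> []" "take (l - i) (drop i u) \<noteq> []" using l that by auto
    ultimately have "drop i u \<prec> m" using LS_word_less_suffix by blast
    moreover have "m \<prec> drop i u" using lm that l by auto
    ultimately show False using less_trans less_irrefl by blast
  qed
  ultimately have "LS_split gt u = l"
    unfolding LS_split_def using l by (intro Least_equality) (auto intro: leI)
  then show ?thesis using lm k l by auto
qed

text \<open>Only the left factor \<open>v\<close> requires an argument. If a proper suffix \<open>y\<close> of \<open>v\<close> precedes \<open>v\<close>, then either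
\<open>yw\<close> precedes \<open>u = vw\<close>, which is impossible in an LS word, or \<open>v = yt\<close> and \<open>tw\<close> precedes \<open>w\<close>, which
contradicts that \<open>w\<close> is the least proper suffix.\<close>

lemma LS_split_factors:
  assumes u: "u \<in> lists Y" "1 < length u" "LS_word gt u"
  obtains v w where "u = v @ w" "v = take (LS_split gt u) u" "w = drop (LS_split gt u) u"
    "LS_word gt v" "LS_word gt w" "v \<in> lists Y" "w \<in> lists Y" "v \<prec> w"
    "v \<noteq> []" "w \<noteq> []"
proof -
  define k where "k = LS_split gt u"
  define v w where "v = take k u" and "w = drop k u"
  have k: "0 < k" "k < length u" "LS_word gt w"
    using LS_split_bounds[OF u(2), of gt] by (auto simp: k_def w_def)
  have uvw: "u = v @ w" "length v = k" using k by (auto simp: v_def w_def)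
  have lists: "v \<in> lists Y" "w \<in> lists Y" using u(1) uvw by auto
  have ne: "v \<noteq> []" "w \<noteq> []" using k uvw by auto
  have least: "w \<prec> s" if "u = p @ s" "p \<noteq> []" "s \<noteq> []" "length p \<noteq> k" for p s
    using drop_LS_split_least[OF u(1,2), of "length p"] that by (auto simp: w_def k_def)
  have "u \<prec> w" using LS_word_less_suffix u uvw ne by blast
  then have vw: "v \<prec> w" using uvw ne less_append less_trans by metis
  have "LS_word gt v"
  proof (rule LS_wordI)
    fix x y assume xy: "v = x @ y" "x \<noteq> []" "y \<noteq> []"
    show "v \<prec> y"
    proof (rule ccontr)
      assume "\<not> v \<prec> y"
      then have yv: "y \<prec> v" using less_total[of y v] lists xy by auto
      have "u = x @ (y @ w)" using xy uvw by auto
      then have uyw: "u \<prec> y @ w" using LS_word_less_suffix[OF u(3,1)] xy by blast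
      show False
      proof (cases "\<exists>t. v = y @ t")
        case True
        then obtain t where t: "v = y @ t" by blast
        then have "t @ w \<prec> w" using uyw uvw by simp
        moreover have "length x = length t" using arg_cong[OF t, of length] arg_cong[OF xy(1), of length] by simp
        then have "t \<noteq> []" using xy(2) by auto
        then have "w \<prec> t @ w"
        proof (intro least[of y "t @ w"])
          show "u = y @ t @ w" using t uvw(1) by simp
          show "length y \<noteq> k" using t \<open>t \<noteq> []\<close> uvw(2) by auto
        qed (use xy \<open>t \<noteq> []\<close> in auto)
        ultimately show False using less_trans less_irrefl by blast
      next
        case False
        then have "y @ w \<prec> v @ w" using yv by (intro less_append_append) auto
        with uyw uvw show False using less_trans less_irrefl by blast
      qed
    qed
  qed (use ne in auto)
  then show ?thesis
    by (rule that[OF uvw(1) v_def[unfolded k_def] w_def[unfolded k_def] _ k(3) lists vw ne])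
qed

text \<open>An LS suffix of \<open>uv\<close> longer than \<open>v\<close> has the form \<open>sv\<close> with \<open>s\<close> a proper suffix of \<open>u\<close>, and \<open>sv \<prec> v\<close>
gives \<open>s \<prec> v\<close>. The least proper suffix of \<open>u\<close> would then also precede \<open>v\<close>, against the assumption.\<close>

lemma LS_split_append:
  assumes u: "LS_word gt u" "u \<in> lists Y" and v: "LS_word gt v" "v \<in> lists Y" and uv: "u \<prec> v"
    and std: "1 < length u \<Longrightarrow> \<not> drop (LS_split gt u) u \<prec> v"
  shows "LS_split gt (u @ v) = length u"
  unfolding LS_split_def
proof (rule Least_equality)
  show "0 < length u \<and> LS_word gt (drop (length u) (u @ v))"
    using u v by (auto simp: LS_word_def)
  fix k assume k: "0 < k \<and> LS_word gt (drop k (u @ v))"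
  show "length u \<le> k"
  proof (rule ccontr)
    assume ku: "\<not> length u \<le> k"
    then have LS: "LS_word gt (drop k u @ v)" and du: "drop k u \<noteq> []" and "v \<noteq> []"
      using k v by (auto simp: LS_word_def)
    moreover have "drop k u @ v \<in> lists Y" using u v by (auto dest: in_set_dropD)
    ultimately have "drop k u @ v \<prec> v" using LS_word_less_suffix by blast
    then have kv: "drop k u \<prec> v" using \<open>v \<noteq> []\<close> less_append less_trans by metis
    have len: "1 < length u" using k ku by auto
    have "drop (LS_split gt u) u \<prec> v"
    proof (cases "k = LS_split gt u")
      case False
      then show ?thesis using drop_LS_split_least[OF u(2) len, of k] k ku kv less_trans by auto
    qed (use kv in simp)
    then show False using std len by blast
  qed
qed

end

section \<open>Operated Lie superalgebras\<close>

context operated_Lie_superalgebra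
begin

lemma zero_hom [simp]: "0 \<in> hom A i"
  using subspace_hom subspace_0 by blast

lemma hom_carr: "a \<in> hom A i \<Longrightarrow> a \<in> carr A"
  unfolding carr_def using zero_hom add_0 add_0_right by (cases i) (force, force)

lemma subspace_carr: "subspace (carr A)"
  unfolding carr_def by (intro subspace_sums subspace_hom)

lemma mul_carr: "a \<in> carr A \<Longrightarrow> b \<in> carr A \<Longrightarrow> mul A a b \<in> carr A"
proof -
  assume a: "a \<in> carr A" and b: "b \<in> carr A"
  from a obtain a0 a1 where a': "a = a0 + a1" "a0 \<in> hom A 0" "a1 \<in> hom A 1"
    by (auto simp: carr_def)
  from b obtain b0 b1 where b': "b = b0 + b1" "b0 \<in> hom A 0" "b1 \<in> hom A 1"
    by (auto simp: carr_def)
  have "mul A a b = (mul A a0 b0 + mul A a0 b1) + (mul A a1 b0 + mul A a1 b1)"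
    using a' b' b hom_carr by (simp add: mul_add_left mul_add_right)
  moreover have "mul A ai bj \<in> carr A" if "ai \<in> hom A i" "bj \<in> hom A j" for ai bj i j
    using that mul_hom hom_carr by blast
  ultimately show ?thesis using a' b' subspace_add[OF subspace_carr] by metis
qed

lemma mul_zero_left [simp]: "b \<in> carr A \<Longrightarrow> mul A 0 b = 0"
  using mul_scl_left[of 0 b 0] zero_hom hom_carr by fastforce

lemma mul_zero_right [simp]: "b \<in> carr A \<Longrightarrow> mul A b 0 = 0"
  using mul_scl_right[of b 0 0] zero_hom hom_carr by fastforce

lemma opr_carr: "a \<in> carr A \<Longrightarrow> opr A a \<in> carr A"
proof -
  assume "a \<in> carr A"
  then obtain a0 a1 where a: "a = a0 + a1" "a0 \<in> hom A 0" "a1 \<in> hom A 1"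
    by (auto simp: carr_def)
  then show ?thesis
    using opr_add[of a0 a1] opr_hom hom_carr unfolding carr_def by blast
qed

text \<open>This and the next two lemmas reduce statements about spans to generators. The product is bilinear only
on the carrier, which is why the generators are required to lie in it.\<close>

lemma mul_span_right:
  assumes V: "subspace V" and B: "B \<subseteq> carr A" and y: "y \<in> carr A"
    and gen: "\<And>b. b \<in> B \<Longrightarrow> mul A y b \<in> V" and x: "x \<in> span B"
  shows "mul A y x \<in> V"
proof -
  have "subspace {x \<in> carr A. mul A y x \<in> V}"
    using V y subspace_carr
    by (auto simp: subspace_def mul_add_right mul_scl_right)
  then have "span B \<subseteq> {x \<in> carr A. mul A y x \<in> V}"
    using gen B by (intro span_minimal) auto
  then show ?thesis using x by auto
qed

lemma mul_span_left:
  assumes V: "subspace V" and B: "B \<subseteq> carr A" and y: "y \<in> carr A"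
    and gen: "\<And>b. b \<in> B \<Longrightarrow> mul A b y \<in> V" and x: "x \<in> span B"
  shows "mul A x y \<in> V"
proof -
  have "subspace {x \<in> carr A. mul A x y \<in> V}"
    using V y subspace_carr
    by (auto simp: subspace_def mul_add_left mul_scl_left)
  then have "span B \<subseteq> {x \<in> carr A. mul A x y \<in> V}"
    using gen B by (intro span_minimal) auto
  then show ?thesis using x by auto
qed

lemma opr_span:
  assumes V: "subspace V" and B: "B \<subseteq> carr A"
    and gen: "\<And>b. b \<in> B \<Longrightarrow> opr A b \<in> V" and x: "x \<in> span B"
  shows "opr A x \<in> V"
proof -
  have "opr A 0 = 0" using opr_scl[of 0 0] zero_hom hom_carr by fastforce
  then have "subspace {x \<in> carr A. opr A x \<in> V}"
    using V subspace_carr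
    by (auto simp: subspace_def opr_add opr_scl)
  then have "span B \<subseteq> {x \<in> carr A. opr A x \<in> V}"
    using gen B by (intro span_minimal) auto
  then show ?thesis using x by auto
qed

lemma skew_subspace:
  assumes "subspace V" "a \<in> hom A i" "b \<in> hom A j" "mul A b a \<in> V"
  shows "mul A a b \<in> V"
  using skew[OF assms(2,3)] assms(1,4) subspace_neg subspace_scale by metis

end

section \<open>Rewriting brackets of super-Lyndon-Shirshov monomials\<close>

primrec eval_magma :: "('v \<Rightarrow> 'v \<Rightarrow> 'v) \<Rightarrow> ('y \<Rightarrow> 'v) \<Rightarrow> 'y magma \<Rightarrow> 'v" where
  "eval_magma f e (Gen y) = e y"
| "eval_magma f e (Br s t) = f (eval_magma f e s) (eval_magma f e t)"

text \<open>The free-algebra situation with a single layer of letters: they may be sent to arbitrary homogeneous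
elements of the right parity. In the application the letters are operated primes.\<close>

locale Lie_superalgebra_letters =
  operated_Lie_superalgebra A + alphabet gt Y
  for A :: "('k::field_char_0, 'v::ab_group_add) operated_superalg"
    and gt :: "'y \<Rightarrow> 'y \<Rightarrow> bool" and Y :: "'y set" +
  fixes pr :: "'y \<Rightarrow> bit" and e :: "'y \<Rightarrow> 'v"
  assumes letter_hom: "y \<in> Y \<Longrightarrow> e y \<in> hom A (pr y)"
begin

notation lex_less (infix "\<prec>" 50)

abbreviation bracket ("\<lbrakk>_, _\<rbrakk>") where "\<lbrakk>a, b\<rbrakk> \<equiv> mul A a b"

definition monomial :: "'y list \<Rightarrow> 'v" where
  "monomial u = eval_magma (mul A) e (SLS_monomial gt u)"

definition LS :: "'y list set" where "LS = {u \<in> lists Y. LS_word gt u}"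

lemma LS_nonempty: "u \<in> LS \<Longrightarrow> u \<noteq> []"
  by (auto simp: LS_def LS_word_def)

lemma LS_length: "u \<in> LS \<Longrightarrow> 0 < length u"
  using LS_nonempty by blast

lemma LS_append: "u \<in> LS \<Longrightarrow> v \<in> LS \<Longrightarrow> u \<prec> v \<Longrightarrow> u @ v \<in> LS"
  using LS_word_append by (auto simp: LS_def)

lemma LS_less_suffix: "v @ w \<in> LS \<Longrightarrow> v \<noteq> [] \<Longrightarrow> w \<noteq> [] \<Longrightarrow> v @ w \<prec> w"
  using LS_word_less_suffix by (auto simp: LS_def)

lemma monomial_letter: "monomial [y] = e y"
  by (simp add: monomial_def SLS_monomial.simps)

lemma monomial_standard:
  assumes "u @ v \<in> LS" "LS_split gt (u @ v) = length u" "1 < length (u @ v)"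
  shows "monomial (u @ v) = \<lbrakk>monomial u, monomial v\<rbrakk>"
  using assms unfolding monomial_def
  by (subst SLS_monomial.simps) (auto simp: LS_def Let_def)

lemma square_not_LS: "\<not> LS_word gt (v @ v)"
  unfolding LS_word_def by (metis append_Nil less_irrefl)

lemma monomial_square:
  assumes "v \<noteq> []"
  shows "monomial (v @ v) = \<lbrakk>monomial v, monomial v\<rbrakk>"
proof -
  have "\<not> length (v @ v) \<le> 1" using assms by (cases v) auto
  then show ?thesis
    unfolding monomial_def using square_not_LS[of v]
    by (subst SLS_monomial.simps) (simp add: Let_def mult_2[symmetric])
qed

lemma monomial_hom: "u \<in> lists Y \<Longrightarrow> u \<noteq> [] \<Longrightarrow> monomial u \<in> hom A (word_parity pr u)"
proof (induction u rule: length_induct)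
  case (1 u)
  show ?case
  proof (cases "length u \<le> 1")
    case True
    then obtain y where "u = [y]" using 1(3) by (cases u) auto
    then show ?thesis
      using 1(2) letter_hom[of y] by (cases "pr y") (auto simp: monomial_letter word_parity_def)
  next
    case False
    define k where "k = (if LS_word gt u then LS_split gt u else length u div 2)"
    have k: "0 < k" "k < length u"
      using False LS_split_bounds[of u gt] by (auto simp: k_def)
    have eq: "monomial u = \<lbrakk>monomial (take k u), monomial (drop k u)\<rbrakk>"
      using False unfolding monomial_def
      by (subst SLS_monomial.simps) (simp add: Let_def k_def[symmetric])
    have "monomial (take k u) \<in> hom A (word_parity pr (take k u))"
      using k 1(2) by (intro 1(1)[rule_format]) (auto dest: in_set_takeD)
    moreover have "monomial (drop k u) \<in> hom A (word_parity pr (drop k u))"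
      using k 1(2) by (intro 1(1)[rule_format]) (auto dest: in_set_dropD)
    moreover have "word_parity pr u = word_parity pr (take k u) + word_parity pr (drop k u)"
      by (metis append_take_drop_id map_append sum_list_append word_parity_def)
    ultimately show ?thesis using mul_hom eq by metis
  qed
qed

lemma LS_hom: "u \<in> LS \<Longrightarrow> monomial u \<in> hom A (word_parity pr u)"
  using monomial_hom LS_nonempty by (auto simp: LS_def)

text \<open>\<open>SLS_element n z x\<close>: \<open>x\<close> is the value of an SLS monomial of length \<open>n\<close> whose root is the LS word \<open>z\<close>.
Measuring SLS words by their root rather than by the word itself is what makes the induction below
decrease: \<open>zz\<close> comes after \<open>z\<close>, but it has the same root.\<close>

inductive SLS_element :: "nat \<Rightarrow> 'y list \<Rightarrow> 'v \<Rightarrow> bool" where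
  single: "z \<in> LS \<Longrightarrow> SLS_element (length z) z (monomial z)"
| square: "z \<in> LS \<Longrightarrow> word_parity pr z = 1 \<Longrightarrow> SLS_element (2 * length z) z \<lbrakk>monomial z, monomial z\<rbrakk>"

definition below :: "nat \<Rightarrow> 'y list \<Rightarrow> 'v set" where
  "below n m = span {x. \<exists>z. SLS_element n z x \<and> z \<prec> m}"

lemma subspace_below: "subspace (below n m)"
  by (simp add: below_def)

lemma SLS_element_hom: "SLS_element n z x \<Longrightarrow> \<exists>i. x \<in> hom A i"
  by (induction rule: SLS_element.induct) (use LS_hom mul_hom in blast)+

lemma SLS_element_carr: "SLS_element n z x \<Longrightarrow> x \<in> carr A"
  using SLS_element_hom hom_carr by blast

lemma SLS_element_LS: "SLS_element n z x \<Longrightarrow> z \<in> LS"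
  by (induction rule: SLS_element.induct)

lemma SLS_element_length: "SLS_element n z x \<Longrightarrow> length z \<le> n"
  by (induction rule: SLS_element.induct) auto

lemma SLS_element_below: "SLS_element n z x \<Longrightarrow> z \<prec> m \<Longrightarrow> x \<in> below n m"
  unfolding below_def by (rule span_base) blast

lemma below_mono: "m \<prec> m' \<Longrightarrow> below n m \<subseteq> below n m'"
  unfolding below_def by (rule span_mono) (use less_trans in blast)

lemma SLS_element_skew:
  assumes "SLS_element n z x" "SLS_element n' z' x'" "subspace V" "\<lbrakk>x', x\<rbrakk> \<in> V"
  shows "\<lbrakk>x, x'\<rbrakk> \<in> V"
proof -
  obtain i j where "x \<in> hom A i" "x' \<in> hom A j" using assms SLS_element_hom by metis
  then show ?thesis using skew_subspace assms by blast
qed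

text \<open>The Jacobi identity whose first two arguments are the odd element \<open>z\<close>.\<close>

lemma square_left:
  assumes z: "z \<in> hom A 1" and d: "d \<in> hom A l"
  shows "\<lbrakk>\<lbrakk>z, z\<rbrakk>, d\<rbrakk> = scl A 2 \<lbrakk>z, \<lbrakk>z, d\<rbrakk>\<rbrakk>"
proof -
  have "\<lbrakk>z, \<lbrakk>z, d\<rbrakk>\<rbrakk> = \<lbrakk>\<lbrakk>z, z\<rbrakk>, d\<rbrakk> - \<lbrakk>z, \<lbrakk>z, d\<rbrakk>\<rbrakk>"
    using jacobi[OF z z d] by (simp add: koszul_def)
  then have "\<lbrakk>\<lbrakk>z, z\<rbrakk>, d\<rbrakk> = \<lbrakk>z, \<lbrakk>z, d\<rbrakk>\<rbrakk> + \<lbrakk>z, \<lbrakk>z, d\<rbrakk>\<rbrakk>" by (simp add: eq_diff_eq)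
  also have "\<dots> = scl A 2 \<lbrakk>z, \<lbrakk>z, d\<rbrakk>\<rbrakk>"
    using scale_left_distrib[of 1 1 "\<lbrakk>z, \<lbrakk>z, d\<rbrakk>\<rbrakk>"] by simp
  finally show ?thesis .
qed

lemma double_zero: "a + a = 0 \<Longrightarrow> a = (0::'v)"
  using scale_left_distrib[of 1 1 a] scale_eq_0_iff[of 2 a] by simp

lemma even_square_zero:
  assumes "z \<in> hom A 0"
  shows "\<lbrakk>z, z\<rbrakk> = 0"
proof (rule double_zero)
  show "\<lbrakk>z, z\<rbrakk> + \<lbrakk>z, z\<rbrakk> = 0"
    by (subst skew[OF assms assms]) (simp add: koszul_def)
qed

text \<open>With \<open>t = [[z,z],z]\<close>, skew symmetry gives \<open>[z,[z,z]] = -t\<close>, and \<open>square_left\<close> turns this into \<open>t = -2t\<close>.\<close>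

lemma odd_cube_zero:
  assumes z: "z \<in> hom A 1"
  shows "\<lbrakk>\<lbrakk>z, z\<rbrakk>, z\<rbrakk> = 0" "\<lbrakk>z, \<lbrakk>z, z\<rbrakk>\<rbrakk> = 0"
proof -
  have zz: "\<lbrakk>z, z\<rbrakk> \<in> hom A 0" using mul_hom[OF z z] by simp
  define t where "t = \<lbrakk>\<lbrakk>z, z\<rbrakk>, z\<rbrakk>"
  have 1: "\<lbrakk>z, \<lbrakk>z, z\<rbrakk>\<rbrakk> = - t" using skew[OF z zz] by (simp add: koszul_def t_def)
  have 2: "scl A 2 (- t) = t" using square_left[OF z z] unfolding 1 t_def[symmetric] by simp
  have "scl A 3 t = t - scl A 2 (- t)"
    using scale_left_distrib[of 1 2 t] by (simp add: scale_minus_right)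
  then have "scl A 3 t = 0" unfolding 2 by simp
  then have "t = 0" by simp
  then show "\<lbrakk>\<lbrakk>z, z\<rbrakk>, z\<rbrakk> = 0" "\<lbrakk>z, \<lbrakk>z, z\<rbrakk>\<rbrakk> = 0" using 1 by (auto simp: t_def)
qed

text \<open>The only nonzero bracket is that of an odd \<open>[z]\<close> with itself, which is the SLS monomial of \<open>zz\<close>.\<close>

lemma SLS_element_same_root:
  assumes "SLS_element n z x" "SLS_element n' z x'"
  shows "\<lbrakk>x, x'\<rbrakk> = 0 \<or> SLS_element (n + n') z \<lbrakk>x, x'\<rbrakk>"
proof -
  define a where "a = monomial z"
  have a: "z \<in> LS" "a \<in> hom A (word_parity pr z)" using assms SLS_element_LS LS_hom by (auto simp: a_def)
  have x: "(n = length z \<and> x = a) \<or> (word_parity pr z = 1 \<and> n = 2 * length z \<and> x = \<lbrakk>a, a\<rbrakk>)"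
    using assms(1) by (auto simp: SLS_element.simps a_def)
  have x': "(n' = length z \<and> x' = a) \<or> (word_parity pr z = 1 \<and> n' = 2 * length z \<and> x' = \<lbrakk>a, a\<rbrakk>)"
    using assms(2) by (auto simp: SLS_element.simps a_def)
  show ?thesis
  proof (cases "word_parity pr z = 1")
    case True
    then have odd: "a \<in> hom A 1" using a by simp
    have zero: "\<lbrakk>\<lbrakk>a, a\<rbrakk>, a\<rbrakk> = 0" "\<lbrakk>a, \<lbrakk>a, a\<rbrakk>\<rbrakk> = 0" using odd_cube_zero[OF odd] by auto
    have "\<lbrakk>\<lbrakk>a, a\<rbrakk>, \<lbrakk>a, a\<rbrakk>\<rbrakk> = 0"
      using square_left[OF odd mul_hom[OF odd odd]] zero hom_carr[OF odd] by simp
    moreover have "SLS_element (length z + length z) z \<lbrakk>a, a\<rbrakk>"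
      using SLS_element.square[OF a(1) True] by (simp add: a_def mult_2)
    ultimately show ?thesis using x x' zero by auto
  next
    case False
    then have "word_parity pr z = 0" by (simp add: bit_not_one_iff)
    then have "\<lbrakk>a, a\<rbrakk> = 0" using even_square_zero a by simp
    then show ?thesis using x x' False by auto
  qed
qed

text \<open>By skew symmetry it is enough to consider brackets whose second argument has the larger root. That the roots in the result are strictly below \<open>m\<close> is what feeds the
induction.\<close>

definition rewritable :: "nat \<Rightarrow> 'y list \<Rightarrow> bool" where
  "rewritable N m \<longleftrightarrow> (\<forall>n z x n' x'. SLS_element n z x \<and> SLS_element n' m x' \<and> z \<prec> m \<and> n + n' = N
    \<longrightarrow> \<lbrakk>x, x'\<rbrakk> \<in> below N m)"

text \<open>As both roots are below \<open>m\<close>, the larger of them is covered by the induction hypothesis; for equal roots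
\<open>SLS_element_same_root\<close> applies.\<close>

lemma bracket_below_gen:
  assumes IH: "\<And>m'. m' \<prec> m \<Longrightarrow> length m' \<le> N \<Longrightarrow> m' \<in> LS \<Longrightarrow> rewritable N m'"
    and x: "SLS_element n z x" "z \<prec> m" and x': "SLS_element n' z' x'" "z' \<prec> m" and N: "n + n' = N"
  shows "\<lbrakk>x, x'\<rbrakk> \<in> below N m"
proof -
  have zLS: "z \<in> LS" "z' \<in> LS" "length z \<le> N" "length z' \<le> N"
    using SLS_element_LS[OF x(1)] SLS_element_LS[OF x'(1)]
      SLS_element_length[OF x(1)] SLS_element_length[OF x'(1)] N by simp_all
  consider "z \<prec> z'" | "z' \<prec> z" | "z = z'" using zLS less_total by (auto simp: LS_def)
  then show ?thesis
  proof cases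
    case 1
    then have "\<lbrakk>x, x'\<rbrakk> \<in> below N z'"
      using IH[OF x'(2) zLS(4) zLS(2)] x(1) x'(1) N unfolding rewritable_def by blast
    then show ?thesis using below_mono x' by blast
  next
    case 2
    then have "\<lbrakk>x', x\<rbrakk> \<in> below N z"
      using IH[OF x(2) zLS(3) zLS(1)] x(1) x'(1) N add.commute[of n n']
      unfolding rewritable_def by metis
    then have "\<lbrakk>x', x\<rbrakk> \<in> below N m" using below_mono x by blast
    then show ?thesis using SLS_element_skew[OF x(1) x'(1) subspace_below] by blast
  next
    case 3
    then show ?thesis
      using SLS_element_same_root[OF x(1), of n' x'] x' x(2) N SLS_element_below subspace_0[OF subspace_below]
      by auto
  qed
qed

lemma bracket_below:
  assumes IH: "\<And>m'. m' \<prec> m \<Longrightarrow> length m' \<le> N \<Longrightarrow> m' \<in> LS \<Longrightarrow> rewritable N m'"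
    and x: "SLS_element n z x" "z \<prec> m" and s: "s \<in> below n' m" and N: "n + n' = N"
  shows "\<lbrakk>x, s\<rbrakk> \<in> below N m"
proof (rule mul_span_right[OF subspace_below _ SLS_element_carr[OF x(1)] _ s[unfolded below_def]])
  show "{x. \<exists>z. SLS_element n' z x \<and> z \<prec> m} \<subseteq> carr A" using SLS_element_carr by blast
  show "\<lbrakk>x, b\<rbrakk> \<in> below N m" if "b \<in> {x. \<exists>z. SLS_element n' z x \<and> z \<prec> m}" for b
    using bracket_below_gen[OF IH x _ _ N] that by blast
qed

text \<open>The induction step: shorter brackets can be rewritten, and so can brackets of the same length with roots
below \<open>m\<close>. The cases are proved in the order in which they depend on each other: two LS words, then a
square of smaller root against anything, then an LS word against a square of root \<open>m\<close>, which falls back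
on the first two.\<close>

lemma rewritable_step:
  assumes shorter: "\<And>N' m'. N' < N \<Longrightarrow> m' \<in> LS \<Longrightarrow> rewritable N' m'"
    and smaller: "\<And>m'. m' \<prec> m \<Longrightarrow> length m' \<le> N \<Longrightarrow> m' \<in> LS \<Longrightarrow> rewritable N m'"
    and m: "m \<in> LS"
  shows "rewritable N m"
proof -
  have short: "\<lbrakk>x, x'\<rbrakk> \<in> below (n + n') m"
    if "SLS_element n z x" "SLS_element n' m x'" "z \<prec> m" "n + n' < N" for n z x n' x'
    using shorter[OF that(4) m] that unfolding rewritable_def by blast
  note combine = bracket_below[OF smaller]
  note m_hom = LS_hom[OF m]
  have LS_case: "\<lbrakk>monomial u, monomial m\<rbrakk> \<in> below N m"
    if u: "u \<in> LS" "u \<prec> m" and N: "length u + length m = N" for u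
  proof (cases "1 < length u \<and> drop (LS_split gt u) u \<prec> m")
    case False
    then have "LS_split gt (u @ m) = length u"
      using u m by (intro LS_split_append) (auto simp: LS_def)
    moreover have "u @ m \<in> LS" using LS_append u m by blast
    moreover have "1 < length (u @ m)"
      using LS_nonempty[OF m] LS_nonempty[OF u(1)] by (cases u; cases m) auto
    ultimately have "\<lbrakk>monomial u, monomial m\<rbrakk> = monomial (u @ m)"
      by (simp add: monomial_standard)
    moreover have "u @ m \<prec> m"
      using LS_less_suffix \<open>u @ m \<in> LS\<close> LS_nonempty u m by blast
    ultimately show ?thesis
      using SLS_element_below[OF SLS_element.single[OF \<open>u @ m \<in> LS\<close>]] N by simp
  next
    case True
    then obtain v w where vw: "u = v @ w" "v = take (LS_split gt u) u" "w = drop (LS_split gt u) u"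
      "v \<in> LS" "w \<in> LS" "v \<prec> w" "v \<noteq> []" "w \<noteq> []"
      using u(1) LS_split_factors[of u] unfolding LS_def by blast
    have less: "w \<prec> m" "v \<prec> m" using True vw less_trans by metis+
    have "LS_split gt u = length v" using LS_split_bounds(2)[of u gt] True vw(2) by simp
    then have eq: "monomial u = \<lbrakk>monomial v, monomial w\<rbrakk>"
      using monomial_standard[of v w] u(1) vw(1) True by simp
    note v = SLS_element.single[OF vw(4)] and w = SLS_element.single[OF vw(5)]
      and me = SLS_element.single[OF m]
    have len: "0 < length v" "0 < length w" using vw(7,8) by auto
    \<comment> \<open>The inner brackets are shorter, hence combinations of elements with roots below \<open>m\<close>.\<close>
    define \<epsilon> where "\<epsilon> = (koszul (word_parity pr v) (word_parity pr w) :: 'k)"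
    have "\<lbrakk>monomial v, \<lbrakk>monomial w, monomial m\<rbrakk>\<rbrakk> \<in> below N m"
      using combine[OF _ _ _ v less(2) short[OF w me less(1)]] N vw(1) len by simp
    moreover have "\<lbrakk>monomial w, \<lbrakk>monomial v, monomial m\<rbrakk>\<rbrakk> \<in> below N m"
      using combine[OF _ _ _ w less(1) short[OF v me less(2)]] N vw(1) len by simp
    moreover have "\<lbrakk>monomial u, monomial m\<rbrakk> = \<lbrakk>monomial v, \<lbrakk>monomial w, monomial m\<rbrakk>\<rbrakk>
        - scl A \<epsilon> \<lbrakk>monomial w, \<lbrakk>monomial v, monomial m\<rbrakk>\<rbrakk>"
      using jacobi[OF LS_hom[OF vw(4)] LS_hom[OF vw(5)] m_hom] eq by (simp add: \<epsilon>_def)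
    ultimately show ?thesis
      using subspace_diff[OF subspace_below] subspace_scale[OF subspace_below] by simp
  qed
  have square_case: "\<lbrakk>\<lbrakk>monomial z, monomial z\<rbrakk>, x'\<rbrakk> \<in> below N m"
    if z: "z \<in> LS" "z \<prec> m" "word_parity pr z = 1" and x': "SLS_element n' m x'"
      and N: "2 * length z + n' = N" for z n' x'
  proof -
    note ze = SLS_element.single[OF z(1)]
    have "\<lbrakk>monomial z, \<lbrakk>monomial z, x'\<rbrakk>\<rbrakk> \<in> below N m"
      using combine[OF _ _ _ ze z(2) short[OF ze x' z(2)]] N LS_length[OF z(1)] by simp
    moreover obtain l where "x' \<in> hom A l" using x' SLS_element_hom by blast
    moreover have "monomial z \<in> hom A 1" using LS_hom[OF z(1)] z(3) by simp
    ultimately show ?thesis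
      using square_left subspace_scale[OF subspace_below] by simp
  qed
  have "\<lbrakk>x, x'\<rbrakk> \<in> below N m"
    if x: "SLS_element n z x" "z \<prec> m" and x': "SLS_element n' m x'" and N: "n + n' = N" for n z x n' x'
    using x(1)
  proof cases
    case square
    then show ?thesis using square_case x(2) x' N by simp
  next
    case single
    note xs = this
    from x' show ?thesis
    proof cases
      case single
      then show ?thesis using LS_case xs x(2) N by simp
    next
      case square
      have odd: "monomial m \<in> hom A 1" using m_hom square by simp
      note me = SLS_element.single[OF m]
      have "\<lbrakk>x, monomial m\<rbrakk> \<in> below (n + length m) m"
        using short[OF x(1) me x(2)] square N LS_length[OF m] by simp
      then have mx: "\<lbrakk>monomial m, x\<rbrakk> \<in> below (n + length m) m"
        using SLS_element_skew[OF me x(1) subspace_below] by blast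
      have "\<lbrakk>monomial m, \<lbrakk>monomial m, x\<rbrakk>\<rbrakk> \<in> below N m"
      proof (rule mul_span_right[OF subspace_below _ SLS_element_carr[OF me] _ mx[unfolded below_def]])
        show "{x. \<exists>z. SLS_element (n + length m) z x \<and> z \<prec> m} \<subseteq> carr A"
          using SLS_element_carr by blast
        fix b assume "b \<in> {x. \<exists>z. SLS_element (n + length m) z x \<and> z \<prec> m}"
        then obtain t where t: "SLS_element (n + length m) t b" "t \<prec> m" by blast
        \<comment> \<open>The larger root of this pair is still \<open>m\<close>, but \<open>m\<close> now enters as an LS word.\<close>
        have "\<lbrakk>b, monomial m\<rbrakk> \<in> below N m"
          using t(1)
        proof cases
          case single
          then show ?thesis using LS_case[of t] t(2) N square by simp
        next
          case sq: square
          then show ?thesis using square_case[OF _ t(2) _ me] N square by simp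
        qed
        then show "\<lbrakk>monomial m, b\<rbrakk> \<in> below N m"
          using SLS_element_skew[OF me t(1) subspace_below] by blast
      qed
      moreover have "\<lbrakk>x', x\<rbrakk> = scl A 2 \<lbrakk>monomial m, \<lbrakk>monomial m, x\<rbrakk>\<rbrakk>"
        using square_left odd SLS_element_hom[OF x(1)] square by blast
      ultimately have "\<lbrakk>x', x\<rbrakk> \<in> below N m" using subspace_scale[OF subspace_below] by simp
      then show ?thesis using SLS_element_skew[OF x(1) x' subspace_below] by blast
    qed
  qed
  then show ?thesis unfolding rewritable_def by blast
qed

text \<open>Over a finite alphabet there are finitely many words of length at most \<open>N\<close>, so the number of those
preceding \<open>m\<close> is an induction measure.\<close>

lemma rewritable_finite:
  assumes fin: "finite Y" and m: "m \<in> LS"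
  shows "rewritable N m"
  using m
proof (induction N arbitrary: m rule: less_induct)
  case (less N)
  note shorter = less.IH
  have words: "finite {w. w \<in> lists Y \<and> length w \<le> N}"
    using finite_lists_length_le[OF fin, of N] by (simp add: lists_eq_set)
  define rank where "rank m = card {w. (w \<in> lists Y \<and> length w \<le> N) \<and> w \<prec> m}" for m
  have rank: "rank m' < rank m" if "m' \<prec> m" "length m' \<le> N" "m' \<in> LS" for m m'
    unfolding rank_def
  proof (rule psubset_card_mono)
    show "finite {w. (w \<in> lists Y \<and> length w \<le> N) \<and> w \<prec> m}"
      using words by (rule rev_finite_subset) blast
    show "{w. (w \<in> lists Y \<and> length w \<le> N) \<and> w \<prec> m'} \<subset> {w. (w \<in> lists Y \<and> length w \<le> N) \<and> w \<prec> m}"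
    proof
      show "{w. (w \<in> lists Y \<and> length w \<le> N) \<and> w \<prec> m'} \<subseteq> {w. (w \<in> lists Y \<and> length w \<le> N) \<and> w \<prec> m}"
        using that(1) less_trans by blast
      have "m' \<in> {w. (w \<in> lists Y \<and> length w \<le> N) \<and> w \<prec> m}" using that by (simp add: LS_def)
      moreover have "m' \<notin> {w. (w \<in> lists Y \<and> length w \<le> N) \<and> w \<prec> m'}" by simp
      ultimately show "{w. (w \<in> lists Y \<and> length w \<le> N) \<and> w \<prec> m'} \<noteq> {w. (w \<in> lists Y \<and> length w \<le> N) \<and> w \<prec> m}"
        by metis
    qed
  qed
  show ?case
    using less.prems
  proof (induction m rule: measure_induct_rule[where f = rank])
    case (less m)
    then show ?case using rewritable_step shorter rank by blast
  qed
qed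

lemma SLS_word_element:
  assumes "u \<in> SLS_words gt pr Y"
  shows "\<exists>n z. SLS_element n z (monomial u)"
proof (cases "LS_word gt u")
  case True
  then have "u \<in> LS" using assms by (auto simp: LS_def SLS_words_def)
  then show ?thesis using SLS_element.single by blast
next
  case False
  then obtain v where v: "LS_word gt v" "word_parity pr v = 1" "u = v @ v" "u \<in> lists Y"
    using assms unfolding SLS_words_def by blast
  then have "v \<in> LS" by (auto simp: LS_def)
  then show ?thesis using SLS_element.square v monomial_square LS_nonempty by metis
qed

lemma SLS_element_word: "SLS_element n z x \<Longrightarrow> x \<in> monomial ` SLS_words gt pr Y"
proof (induction rule: SLS_element.induct)
  case (square z)
  then have "z @ z \<in> SLS_words gt pr Y" by (auto simp: SLS_words_def LS_def)
  then show ?case using monomial_square[OF LS_nonempty[OF square(1)]] by (metis imageI)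
qed (auto simp: SLS_words_def LS_def)

lemma bracket_SLS_finite:
  assumes fin: "finite Y" and u: "u \<in> SLS_words gt pr Y" and v: "v \<in> SLS_words gt pr Y"
  shows "\<lbrakk>monomial u, monomial v\<rbrakk> \<in> span (monomial ` SLS_words gt pr Y)"
proof -
  obtain n z where x: "SLS_element n z (monomial u)" using SLS_word_element u by blast
  obtain n' z' where x': "SLS_element n' z' (monomial v)" using SLS_word_element v by blast
  have below: "below k m \<subseteq> span (monomial ` SLS_words gt pr Y)" for k m
    unfolding below_def by (rule span_mono) (use SLS_element_word in blast)
  note z = SLS_element_LS[OF x] SLS_element_LS[OF x']
  then consider "z \<prec> z'" | "z' \<prec> z" | "z = z'" using less_total by (auto simp: LS_def)
  then show ?thesis
  proof cases
    case 1
    then show ?thesis using rewritable_finite[OF fin] z x x' below unfolding rewritable_def by blast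
  next
    case 2
    then have "\<lbrakk>monomial v, monomial u\<rbrakk> \<in> span (monomial ` SLS_words gt pr Y)"
      using rewritable_finite[OF fin] z x x' below unfolding rewritable_def by blast
    then show ?thesis using SLS_element_skew[OF x x' subspace_span] by blast
  next
    case 3
    then show ?thesis
      using SLS_element_same_root[OF x, of n'] x' SLS_element_word span_base span_zero by metis
  qed
qed

text \<open>Only the letters that occur in the two words matter, so that the finite case suffices.\<close>

lemma bracket_SLS:
  assumes u: "u \<in> SLS_words gt pr Y" and v: "v \<in> SLS_words gt pr Y"
  shows "\<lbrakk>monomial u, monomial v\<rbrakk> \<in> span (monomial ` SLS_words gt pr Y)"
proof -
  let ?Y = "set u \<union> set v"
  have Y: "?Y \<subseteq> Y" using u v by (auto simp: SLS_words_def)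
  interpret fin: Lie_superalgebra_letters A gt ?Y pr e
    using Y gt_irrefl gt_trans gt_total letter_hom by unfold_locales blast+
  have "u \<in> SLS_words gt pr ?Y" "v \<in> SLS_words gt pr ?Y" using u v by (auto simp: SLS_words_def)
  then have "mul A (monomial u) (monomial v) \<in> span (monomial ` SLS_words gt pr ?Y)"
    using fin.bracket_SLS_finite by simp
  moreover have "SLS_words gt pr ?Y \<subseteq> SLS_words gt pr Y" using Y by (auto simp: SLS_words_def)
  ultimately show ?thesis using span_mono[OF image_mono] by blast
qed

end

section \<open>Operated words and their order\<close>

text \<open>The letters of which operated words over \<open>X\<close> consist, generated at once instead of by depth.\<close>

inductive_set operated_primes :: "'x set \<Rightarrow> 'x oprime set" for X where
  Letter: "x \<in> X \<Longrightarrow> Letter x \<in> operated_primes X"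
| OpLetter: "w \<in> lists (operated_primes X) \<Longrightarrow> w \<noteq> [] \<Longrightarrow> OpLetter w \<in> operated_primes X"
monos lists_mono

inductive_simps Letter_operated_primes [simp]: "Letter x \<in> operated_primes X"
inductive_simps OpLetter_operated_primes [simp]: "OpLetter w \<in> operated_primes X"

lemma operated_words_upto_mono: "n \<le> m \<Longrightarrow> operated_words_upto X n \<subseteq> operated_words_upto X m"
proof (rule lift_Suc_mono_le[of "operated_words_upto X"])
  show "operated_words_upto X n \<subseteq> operated_words_upto X (Suc n)" for n
  proof (induction n)
    case (Suc n)
    then have "lists (Letter ` X \<union> OpLetter ` operated_words_upto X n)
        \<subseteq> lists (Letter ` X \<union> OpLetter ` operated_words_upto X (Suc n))"
      by (intro lists_mono Un_mono image_mono) auto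
    then show ?case by auto
  qed auto
qed auto

text \<open>A word has finitely many primes, so the depths at which they appear have a common bound.\<close>

lemma operated_words_eq: "operated_words X = lists (operated_primes X) - {[]}"
proof (intro equalityI subsetI)
  have "operated_words_upto X n \<subseteq> lists (operated_primes X) - {[]}" for n
  proof (induction n)
    case (Suc n)
    have "Letter ` X \<union> OpLetter ` operated_words_upto X n \<subseteq> operated_primes X"
      using Suc by auto
    then have "lists (Letter ` X \<union> OpLetter ` operated_words_upto X n) \<subseteq> lists (operated_primes X)"
      by (rule lists_mono)
    then show ?case unfolding operated_words_upto.simps by blast
  qed auto
  then show "w \<in> operated_words X \<Longrightarrow> w \<in> lists (operated_primes X) - {[]}" for w
    unfolding operated_words_def by blast
next
  define L where "L n = Letter ` X \<union> OpLetter ` operated_words_upto X n" for n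
  have L_mono: "n \<le> m \<Longrightarrow> L n \<subseteq> L m" for n m
    unfolding L_def using operated_words_upto_mono[of n m X] by auto
  have upto_L: "w \<in> operated_words_upto X (Suc n)" if "set w \<subseteq> L n" "w \<noteq> []" for w n
    using that by (auto simp: L_def)
  have words: "\<exists>n. set w \<subseteq> L n" if "\<forall>p\<in>set w. \<exists>n. p \<in> L n" for w
    using that
  proof (induction w)
    case (Cons p w)
    then obtain n m where "p \<in> L n" "set w \<subseteq> L m" by auto
    then have "set (p # w) \<subseteq> L (max n m)"
      using L_mono[of n "max n m"] L_mono[of m "max n m"] by auto
    then show ?case by blast
  qed auto
  have primes: "\<exists>n. p \<in> L n" if "p \<in> operated_primes X" for p
    using that
  proof (induction rule: operated_primes.induct)
    case (OpLetter w)
    then have "\<forall>p\<in>set w. \<exists>n. p \<in> L n" by auto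
    then obtain n where "set w \<subseteq> L n" using words by blast
    then have "w \<in> operated_words_upto X (Suc n)" using OpLetter(2) upto_L by blast
    then show ?case unfolding L_def by blast
  qed (auto simp: L_def)
  fix w assume w: "w \<in> lists (operated_primes X) - {[]}"
  then have "\<forall>p\<in>set w. \<exists>n. p \<in> L n" using primes by auto
  then obtain n where "set w \<subseteq> L n" using words by blast
  then have "w \<in> operated_words_upto X (Suc n)" using w upto_L by blast
  then show "w \<in> operated_words X" unfolding operated_words_def by blast
qed

lemma prime_gt_irrefl: "\<not> prime_gt r p p"
proof (induction p)
  case (OpLetter w)
  then have "\<not> lex_gt (prime_gt r) w w" by (intro lex_gt_irrefl) blast
  then show ?case by (simp add: prime_gt.simps[of _ "OpLetter w"] Dl_gt.simps)
qed (simp add: prime_gt.simps)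

lemma prime_gt_trans:
  assumes r: "trans r" "antisym r"
  shows "prime_gt r p q \<Longrightarrow> prime_gt r q s \<Longrightarrow> prime_gt r p s"
proof (induction p arbitrary: q s)
  case (Letter x)
  then show ?case
    using transD[OF r(1)] antisymD[OF r(2)]
    by (auto simp: prime_gt.simps split: oprime.splits)
next
  case (OpLetter w)
  have "lex_gt (prime_gt r) w v \<Longrightarrow> lex_gt (prime_gt r) v t \<Longrightarrow> lex_gt (prime_gt r) w t" for v t
    by (rule lex_gt_trans[of w _ v]) (blast intro: OpLetter.IH)+
  then show ?case
    using OpLetter.prems
    by (auto simp: prime_gt.simps Dl_gt.simps split: oprime.splits)
qed

lemma prime_Deg_pos: "0 < prime_Deg p"
  by (cases p) auto

lemma prime_Deg_OpLetter: "w \<noteq> [] \<Longrightarrow> prime_Deg (OpLetter w) > 1"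
  using prime_Deg_pos by (cases w) auto

text \<open>A letter and a prime \<open>P(w)\<close> with \<open>w\<close> nonempty have different degrees, so that only primes of the same kind
have to be compared.\<close>

lemma prime_gt_total:
  assumes r: "total_on X r"
  shows "p \<in> operated_primes X \<Longrightarrow> q \<in> operated_primes X \<Longrightarrow> p \<noteq> q \<Longrightarrow>
    prime_gt r p q \<or> prime_gt r q p"
proof (induction p arbitrary: q)
  case (Letter x)
  show ?case
  proof (cases q)
    case (OpLetter v)
    then have "prime_Deg q > 1" using Letter(2) prime_Deg_OpLetter by auto
    then show ?thesis by (simp add: prime_gt.simps)
  qed (use Letter r in \<open>auto simp: prime_gt.simps total_on_def\<close>)
next
  case (OpLetter w)
  show ?case
  proof (cases q)
    case (Letter y)
    have "prime_Deg (OpLetter w) > 1" using OpLetter(2) prime_Deg_OpLetter by auto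
    then show ?thesis using Letter by (simp add: prime_gt.simps)
  next
    case q: (OpLetter v)
    have "lex_gt (prime_gt r) w v \<or> lex_gt (prime_gt r) v w"
    proof (rule lex_gt_total)
      show "w \<noteq> v" using OpLetter.prems q by auto
      show "prime_gt r y z \<or> prime_gt r z y" if "y \<in> set w" "z \<in> set v" "y \<noteq> z" for y z
        using OpLetter.IH[OF that(1), of z] that OpLetter.prems q by auto
    qed
    then show ?thesis using q by (auto simp: prime_gt.simps Dl_gt.simps)
  qed
qed

lemma alphabet_primes:
  assumes "well_order_on X r" and "Y \<subseteq> operated_primes X"
  shows "alphabet (prime_gt r) Y"
proof -
  have "trans r" "antisym r" "total_on X r"
    using assms(1) by (auto simp: well_order_on_def linear_order_on_def partial_order_on_def preorder_on_def)
  note r = this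
  show ?thesis
  proof
    show "prime_gt r y z \<or> prime_gt r z y" if "y \<in> Y" "z \<in> Y" "y \<noteq> z" for y z
      using prime_gt_total[OF r(3)] that assms(2) by blast
  qed (simp add: prime_gt_irrefl, rule prime_gt_trans[OF r(1,2)])
qed

lemma SLS_words_mono: "Y \<subseteq> Y' \<Longrightarrow> SLS_words gt par Y \<subseteq> SLS_words gt par Y'"
  by (auto simp: SLS_words_def)

lemma SLS_words_nonempty: "u \<in> SLS_words gt par Y \<Longrightarrow> u \<noteq> []"
  by (auto simp: SLS_words_def LS_word_def)

lemma SLS_words_lists: "u \<in> SLS_words gt par Y \<Longrightarrow> u \<in> lists Y"
  by (auto simp: SLS_words_def)

lemma OSLS_letters_primes: "OSLS_letters r par X n \<subseteq> operated_primes X"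
proof (induction n)
  case (Suc n)
  then have "OpLetter w \<in> operated_primes X"
    if "w \<in> SLS_words (prime_gt r) (prime_parity par) (OSLS_letters r par X n)" for w
    using SLS_words_lists[OF that] SLS_words_nonempty[OF that] by auto
  then show ?case by auto
qed auto

lemma OSLS_letters_mono: "n \<le> m \<Longrightarrow> OSLS_letters r par X n \<subseteq> OSLS_letters r par X m"
proof (rule lift_Suc_mono_le[of "OSLS_letters r par X"])
  show "OSLS_letters r par X n \<subseteq> OSLS_letters r par X (Suc n)" for n
  proof (induction n)
    case (Suc n)
    then show ?case using SLS_words_mono by fastforce
  qed auto
qed auto

lemma OSLSW_upto_mono: "n \<le> m \<Longrightarrow> OSLSW_upto r par X n \<subseteq> OSLSW_upto r par X m"
  unfolding OSLSW_upto_def by (intro SLS_words_mono OSLS_letters_mono)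

lemma OSLSW_lists: "w \<in> OSLSW r par X \<Longrightarrow> w \<in> lists (operated_primes X) - {[]}"
  using SLS_words_lists SLS_words_nonempty OSLS_letters_primes
  unfolding OSLSW_def OSLSW_upto_def by blast

lemma OpLetter_OSLSW: "w \<in> OSLSW r par X \<Longrightarrow> [OpLetter w] \<in> OSLSW r par X"
proof -
  assume "w \<in> OSLSW r par X"
  then obtain n where "w \<in> OSLSW_upto r par X n" by (auto simp: OSLSW_def)
  then have "[OpLetter w] \<in> OSLSW_upto r par X (Suc n)"
    by (simp add: OSLSW_upto_def SLS_words_def)
  then show ?thesis unfolding OSLSW_def by blast
qed

lemma Letter_OSLSW: "x \<in> X \<Longrightarrow> [Letter x] \<in> OSLSW r par X"
  unfolding OSLSW_def OSLSW_upto_def by (intro UN_I[of 0]) (auto simp: SLS_words_def)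

lemma bracketing_prime: "bracketing r [p] = prime_bracketing r p"
  by (simp add: bracketing.simps SLS_monomial.simps)

lemma set_omonomial_graft: "set_omonomial (graft (map_magma f t)) = (\<Union>p\<in>set_magma t. set_omonomial (f p))"
  by (induction t) auto

lemma set_bracketing:
  assumes "w \<in> lists (operated_primes X) - {[]}"
  shows "set_omonomial (bracketing r w) \<subseteq> X"
proof -
  have *: "set_omonomial (bracketing r w) \<subseteq> X"
    if "w \<noteq> []" "\<forall>p\<in>set w. set_omonomial (prime_bracketing r p) \<subseteq> X" for w
    using that set_SLS_monomial[OF that(1), of "prime_gt r"]
    by (auto simp: bracketing.simps set_omonomial_graft)
  have "set_omonomial (prime_bracketing r p) \<subseteq> X" if "p \<in> operated_primes X" for p
    using that
  proof (induction rule: operated_primes.induct)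
    case (OpLetter w)
    then show ?case using *[of w] by auto
  qed auto
  then have "\<forall>p\<in>set w. set_omonomial (prime_bracketing r p) \<subseteq> X" using assms by auto
  then show ?thesis using *[of w] assms by blast
qed

section \<open>Evaluating operated super-Lyndon-Shirshov monomials\<close>

text \<open>The value of a monomial in an arbitrary algebra; \<^const>\<open>interp\<close> is the case of \<open>OAS(X)\<close>.\<close>

primrec eval_omonomial ::
  "('k, 'v) operated_superalg \<Rightarrow> ('x \<Rightarrow> 'v) \<Rightarrow> 'x omonomial \<Rightarrow> 'v" where
  "eval_omonomial A j (MLetter x) = j x"
| "eval_omonomial A j (MOp m) = opr A (eval_omonomial A j m)"
| "eval_omonomial A j (MBr s t) = mul A (eval_omonomial A j s) (eval_omonomial A j t)"

lemma eval_omonomial_graft: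
  "eval_omonomial A j (graft (map_magma f t)) = eval_magma (mul A) (\<lambda>p. eval_omonomial A j (f p)) t"
  by (induction t) auto

text \<open>An operated Lie superalgebra with an even map from \<open>X\<close>, as in the universal property. The spanning
statement is proved in this generality because it is applied to \<open>OAS(X)\<close> and to its product with a
test algebra.\<close>

locale operated_evaluation =
  operated_Lie_superalgebra A
  for A :: "('k::field_char_0, 'v::ab_group_add) operated_superalg" +
  fixes X :: "'x set" and r :: "'x rel" and par :: "'x \<Rightarrow> bit" and j :: "'x \<Rightarrow> 'v"
  assumes well_order: "well_order_on X r" and even: "even_map X par A j"
begin

abbreviation eval where "eval \<equiv> eval_omonomial A j"

text \<open>Apart from \<open>X\<close>, the letters of depth \<open>n + 1\<close> are operators applied to SLS monomials in letters of depth \<open>n\<close>, so the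
parities are right by induction on the depth.\<close>

lemma letters_hom: "p \<in> OSLS_letters r par X n \<Longrightarrow> eval (prime_bracketing r p) \<in> hom A (prime_parity par p)"
proof (induction n arbitrary: p)
  case 0
  then show ?case using even by (auto simp: even_map_def)
next
  case (Suc n)
  let ?Y = "OSLS_letters r par X n"
  interpret alphabet "prime_gt r" ?Y
    using alphabet_primes well_order OSLS_letters_primes by blast
  interpret Lie_superalgebra_letters A "prime_gt r" ?Y "prime_parity par"
    "\<lambda>p. eval (prime_bracketing r p)"
    using Suc.IH by unfold_locales
  have "eval (bracketing r w) \<in> hom A (oword_parity par w)"
    if "w \<in> SLS_words (prime_gt r) (prime_parity par) ?Y" for w
    using monomial_hom SLS_words_lists[OF that] SLS_words_nonempty[OF that]
    by (simp add: monomial_def bracketing.simps eval_omonomial_graft)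
  then show ?case
    using Suc.prems even opr_hom by (auto simp: even_map_def word_parity_def)
qed

lemma letters: "Lie_superalgebra_letters A (prime_gt r) (OSLS_letters r par X n) (prime_parity par)
    (\<lambda>p. eval (prime_bracketing r p))"
proof -
  interpret alphabet "prime_gt r" "OSLS_letters r par X n"
    using alphabet_primes well_order OSLS_letters_primes by blast
  show ?thesis using letters_hom by unfold_locales
qed

lemma eval_bracketing:
  "u \<noteq> [] \<Longrightarrow> eval (bracketing r u) =
    Lie_superalgebra_letters.monomial A (prime_gt r) (\<lambda>p. eval (prime_bracketing r p)) u"
  by (simp add: Lie_superalgebra_letters.monomial_def[OF letters] bracketing.simps eval_omonomial_graft)

lemma OSLSW_hom: "u \<in> OSLSW r par X \<Longrightarrow> eval (bracketing r u) \<in> hom A (oword_parity par u)"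
  unfolding OSLSW_def OSLSW_upto_def
  using Lie_superalgebra_letters.monomial_hom[OF letters] eval_bracketing
    SLS_words_lists SLS_words_nonempty by (metis UN_E)

definition OSLSM_span :: "'v set" where "OSLSM_span = span (eval ` OSLSM r par X)"

lemma subspace_OSLSM_span: "subspace OSLSM_span"
  by (simp add: OSLSM_span_def)

lemma OSLSM_hom: "a \<in> eval ` OSLSM r par X \<Longrightarrow> \<exists>i. a \<in> hom A i"
  using OSLSW_hom by (auto simp: OSLSM_def)

lemma OSLSM_carr: "eval ` OSLSM r par X \<subseteq> carr A"
  using OSLSM_hom hom_carr by blast

lemma OSLSW_in_span: "u \<in> OSLSW r par X \<Longrightarrow> eval (bracketing r u) \<in> OSLSM_span"
  unfolding OSLSM_span_def OSLSM_def by (intro span_base) blast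

lemma OSLSM_span_letter: "x \<in> X \<Longrightarrow> j x \<in> OSLSM_span"
  using OSLSW_in_span[OF Letter_OSLSW] by (simp add: bracketing_prime)

text \<open>If \<open>w\<close> is an operated SLS word, then so is the one-letter word \<open>P(w)\<close>.\<close>

lemma OSLSM_span_opr: "a \<in> OSLSM_span \<Longrightarrow> opr A a \<in> OSLSM_span"
proof (rule opr_span[OF subspace_OSLSM_span OSLSM_carr])
  fix b assume "b \<in> eval ` OSLSM r par X"
  then obtain u where u: "u \<in> OSLSW r par X" "b = eval (bracketing r u)" by (auto simp: OSLSM_def)
  then show "opr A b \<in> OSLSM_span"
    using OSLSW_in_span[OF OpLetter_OSLSW[OF u(1)]] by (simp add: bracketing_prime)
qed (simp add: OSLSM_span_def)

text \<open>Two operated SLS words have a common depth bound \<open>n\<close>, so they are SLS words over the same alphabet, the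
letters of depth at most \<open>n\<close>, to which \<open>bracket_SLS\<close> applies.\<close>

lemma OSLSW_mul:
  assumes u: "u \<in> OSLSW r par X" and v: "v \<in> OSLSW r par X"
  shows "mul A (eval (bracketing r u)) (eval (bracketing r v)) \<in> OSLSM_span"
proof -
  obtain n m where "u \<in> OSLSW_upto r par X n" "v \<in> OSLSW_upto r par X m"
    using u v by (auto simp: OSLSW_def)
  then have uv: "u \<in> OSLSW_upto r par X (max n m)" "v \<in> OSLSW_upto r par X (max n m)"
    using OSLSW_upto_mono[of n "max n m" r par X] OSLSW_upto_mono[of m "max n m" r par X] by auto
  interpret Y: Lie_superalgebra_letters A "prime_gt r" "OSLS_letters r par X (max n m)"
    "prime_parity par" "\<lambda>p. eval (prime_bracketing r p)"
    by (rule letters)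
  have ne: "w \<noteq> []" if "w \<in> OSLSW_upto r par X (max n m)" for w
    using that SLS_words_nonempty unfolding OSLSW_upto_def by blast
  have "Y.monomial ` OSLSW_upto r par X (max n m) \<subseteq> eval ` OSLSM r par X"
  proof (rule image_subsetI)
    fix w assume w: "w \<in> OSLSW_upto r par X (max n m)"
    then have "bracketing r w \<in> OSLSM r par X" unfolding OSLSM_def OSLSW_def by blast
    then show "Y.monomial w \<in> eval ` OSLSM r par X"
      using eval_bracketing[OF ne[OF w]] by (metis imageI)
  qed
  then have "span (Y.monomial ` OSLSW_upto r par X (max n m)) \<subseteq> OSLSM_span"
    unfolding OSLSM_span_def by (rule span_mono)
  then show ?thesis
    using Y.bracket_SLS[of u v] uv eval_bracketing[OF ne[OF uv(1)]] eval_bracketing[OF ne[OF uv(2)]]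
    unfolding OSLSW_upto_def by auto
qed

lemma OSLSM_span_mul:
  assumes "a \<in> OSLSM_span" "b \<in> OSLSM_span"
  shows "mul A a b \<in> OSLSM_span"
proof -
  have gen: "mul A a b \<in> OSLSM_span" if "a \<in> OSLSM_span" "b \<in> eval ` OSLSM r par X" for a b
  proof (rule mul_span_left[OF subspace_OSLSM_span OSLSM_carr])
    show "b \<in> carr A" using that OSLSM_carr by blast
    show "a \<in> span (eval ` OSLSM r par X)" using that by (simp add: OSLSM_span_def)
    show "mul A c b \<in> OSLSM_span" if "c \<in> eval ` OSLSM r par X" for c
      using that \<open>b \<in> eval ` OSLSM r par X\<close> OSLSW_mul by (auto simp: OSLSM_def)
  qed
  show ?thesis
  proof (rule mul_span_right[OF subspace_OSLSM_span OSLSM_carr])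
    show "a \<in> carr A"
      using assms(1) span_minimal[OF OSLSM_carr subspace_carr] by (auto simp: OSLSM_span_def)
    show "b \<in> span (eval ` OSLSM r par X)" using assms(2) by (simp add: OSLSM_span_def)
  qed (use gen assms in blast)
qed

end

section \<open>The operated Lie superalgebra of operated polynomials\<close>

abbreviation "coeff \<equiv> Poly_Mapping.lookup"
abbreviation "support \<equiv> Poly_Mapping.keys"

lemma sum_singles: "(\<Sum>w\<in>support f. Poly_Mapping.single w (coeff f w)) = f"
  by (rule poly_mapping_eqI)
    (auto simp: lookup_sum lookup_single when_def in_keys_iff sum.delta)

text \<open>Multilinear identities need only be checked on words.\<close>

lemma oas_induct [case_names single add]:
  assumes "\<And>w c. P (Poly_Mapping.single w c)" "\<And>f g. P f \<Longrightarrow> P g \<Longrightarrow> P (f + g)"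
  shows "P (f :: 'a \<Rightarrow>\<^sub>0 'b::comm_monoid_add)"
proof -
  have "P (\<Sum>w\<in>W. Poly_Mapping.single w (coeff f w))" if "finite W" for W
    using that
  proof (induction W)
    case empty
    then show ?case using assms(1)[of undefined 0] by simp
  qed (use assms in auto)
  then show ?thesis using sum_singles[of f] finite_keys by metis
qed

lemma coeff_scale [simp]: "coeff (oas_scale c f) w = c * coeff f w"
  by (simp add: oas_scale_def Poly_Mapping.map.rep_eq when_def)

lemma vector_space_oas: "vector_space (oas_scale :: 'k::field \<Rightarrow> ('x, 'k) oas \<Rightarrow> _)"
  by unfold_locales (auto intro!: poly_mapping_eqI simp: lookup_add algebra_simps)

interpretation oas: vector_space "oas_scale :: 'k::field \<Rightarrow> ('x, 'k) oas \<Rightarrow> _"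
  by (rule vector_space_oas)

lemma scale_single: "oas_scale c (Poly_Mapping.single w a) = Poly_Mapping.single w (c * a)"
  by (rule poly_mapping_eqI) (simp add: lookup_single when_def)

lemma oas_mult_add_left: "oas_mult (f + f') g = oas_mult f g + oas_mult f' g"
  unfolding oas_mult_def
  by (rule setsum_keys_plus_distrib) (simp_all add: algebra_simps single_add sum.distrib)

lemma oas_mult_add_right: "oas_mult f (g + g') = oas_mult f g + oas_mult f g'"
proof -
  have "(\<Sum>v\<in>support (g + g'). Poly_Mapping.single (u @ v) (coeff f u * coeff (g + g') v)) =
    (\<Sum>v\<in>support g. Poly_Mapping.single (u @ v) (coeff f u * coeff g v)) +
    (\<Sum>v\<in>support g'. Poly_Mapping.single (u @ v) (coeff f u * coeff g' v))" for u
    by (rule setsum_keys_plus_distrib) (simp_all add: algebra_simps single_add)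
  then show ?thesis unfolding oas_mult_def by (simp add: sum.distrib)
qed

lemma oas_mult_single: "oas_mult (Poly_Mapping.single u a) (Poly_Mapping.single v b) = Poly_Mapping.single (u @ v) (a * b)"
  by (simp add: oas_mult_def)

lemma oas_mult_scale_left: "oas_mult (oas_scale c f) g = oas_scale c (oas_mult f g)"
proof (induction f rule: oas_induct)
  case (single w a)
  show ?case
    by (induction g rule: oas_induct)
      (simp_all add: oas_mult_single scale_single oas_mult_add_right oas.scale_right_distrib algebra_simps)
qed (simp add: oas_mult_add_left oas.scale_right_distrib)

lemma oas_mult_scale_right: "oas_mult f (oas_scale c g) = oas_scale c (oas_mult f g)"
proof (induction f rule: oas_induct)
  case (single w a)
  show ?case
    by (induction g rule: oas_induct)
      (simp_all add: oas_mult_single scale_single oas_mult_add_right oas.scale_right_distrib algebra_simps)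
qed (simp add: oas_mult_add_left oas.scale_right_distrib)

lemma oas_mult_assoc: "oas_mult (oas_mult f g) h = oas_mult f (oas_mult g h)"
proof (induction f rule: oas_induct)
  case (single u a)
  show ?case
  proof (induction g rule: oas_induct)
    case (single v b)
    show ?case
      by (induction h rule: oas_induct) (simp_all add: oas_mult_single oas_mult_add_right algebra_simps)
  qed (simp add: oas_mult_add_left oas_mult_add_right)
qed (simp add: oas_mult_add_left)

lemma oas_mult_minus_left: "oas_mult (- f) g = - oas_mult f g"
  using oas_mult_scale_left[of "-1" f g] by simp

lemma oas_mult_minus_right: "oas_mult f (- g) = - oas_mult f g"
  using oas_mult_scale_right[of f "-1" g] by simp

lemma oas_mult_diff_left: "oas_mult (f - f') g = oas_mult f g - oas_mult f' g"
  using oas_mult_add_left[of f "- f'" g] by (simp add: oas_mult_minus_left)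

lemma oas_mult_diff_right: "oas_mult f (g - g') = oas_mult f g - oas_mult f g'"
  using oas_mult_add_right[of f g "- g'"] by (simp add: oas_mult_minus_right)

lemma oas_mult_zero [simp]: "oas_mult 0 g = 0" "oas_mult f 0 = 0"
  by (simp_all add: oas_mult_def)

lemma oas_op_add: "oas_op (f + g) = oas_op f + oas_op g"
  unfolding oas_op_def by (rule setsum_keys_plus_distrib) (simp_all add: single_add)

lemma oas_op_single: "oas_op (Poly_Mapping.single w a) = Poly_Mapping.single [OpLetter w] a"
  by (simp add: oas_op_def)

lemma oas_op_scale: "oas_op (oas_scale c f) = oas_scale c (oas_op f)"
  by (induction f rule: oas_induct)
    (simp_all add: oas_op_single scale_single oas_op_add oas.scale_right_distrib)

lemma coeff_op: "coeff (oas_op f) v = (case v of [OpLetter w] \<Rightarrow> coeff f w | _ \<Rightarrow> 0)"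
proof (induction f rule: oas_induct)
  case (single w a)
  then show ?case
    by (auto simp: oas_op_single lookup_single when_def split: list.splits oprime.splits)
qed (auto simp: oas_op_add lookup_add split: list.splits oprime.splits)

lemma coeff_component: "coeff (oas_component par i f) w = (if oword_parity par w = i then coeff f w else 0)"
  unfolding oas_component_def
  by (auto simp: lookup_sum lookup_single when_def in_keys_iff sum.delta)

lemma component_add: "oas_component par i (f + g) = oas_component par i f + oas_component par i g"
  by (rule poly_mapping_eqI) (simp add: coeff_component lookup_add)

lemma component_scale: "oas_component par i (oas_scale c f) = oas_scale c (oas_component par i f)"
  by (rule poly_mapping_eqI) (simp add: coeff_component)

lemma bracket_add_left: "oas_bracket par (f + f') g = oas_bracket par f g + oas_bracket par f' g"
  by (simp add: oas_bracket_def component_add oas_mult_add_left oas_mult_add_right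
      oas.scale_right_distrib algebra_simps)

lemma bracket_add_right: "oas_bracket par f (g + g') = oas_bracket par f g + oas_bracket par f g'"
  by (simp add: oas_bracket_def component_add oas_mult_add_left oas_mult_add_right
      oas.scale_right_distrib algebra_simps)

lemma bracket_scale_left: "oas_bracket par (oas_scale c f) g = oas_scale c (oas_bracket par f g)"
  by (simp add: oas_bracket_def component_scale oas_mult_scale_left oas_mult_scale_right
      oas.scale_right_distrib oas.scale_right_diff_distrib algebra_simps)

lemma bracket_scale_right: "oas_bracket par f (oas_scale c g) = oas_scale c (oas_bracket par f g)"
  by (simp add: oas_bracket_def component_scale oas_mult_scale_left oas_mult_scale_right
      oas.scale_right_distrib oas.scale_right_diff_distrib algebra_simps)

text \<open>The parity components of \<open>OAS(X)\<close>, named so that they can be used without the record.\<close>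

definition homogeneous :: "'x set \<Rightarrow> ('x \<Rightarrow> bit) \<Rightarrow> bit \<Rightarrow> ('x, 'k::field) oas set" where
  "homogeneous X par i = {f. \<forall>w\<in>support f. w \<in> operated_words X \<and> oword_parity par w = i}"

lemma subspace_homogeneous: "oas.subspace (homogeneous X par i)"
proof (rule oas.subspaceI)
  show "0 \<in> homogeneous X par i" by (simp add: homogeneous_def)
  show "f + g \<in> homogeneous X par i" if "f \<in> homogeneous X par i" "g \<in> homogeneous X par i" for f g
    using that keys_add[of f g] unfolding homogeneous_def by blast
  show "oas_scale c f \<in> homogeneous X par i" if "f \<in> homogeneous X par i" for c f
    using that unfolding homogeneous_def by (auto simp: in_keys_iff)
qed

lemma component_homogeneous:
  assumes "f \<in> homogeneous X par i"
  shows "oas_component par j f = (if i = j then f else 0)"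
  using assms
  by (intro poly_mapping_eqI) (auto simp: coeff_component homogeneous_def in_keys_iff)

lemma bracket_homogeneous:
  assumes "f \<in> homogeneous X par i" "g \<in> homogeneous X par j"
  shows "oas_bracket par f g = oas_mult f g - oas_scale (koszul i j) (oas_mult g f)"
  unfolding oas_bracket_def component_homogeneous[OF assms(1)] component_homogeneous[OF assms(2)]
  by (cases i; cases j) simp_all

lemma operated_words_append: "u \<in> operated_words X \<Longrightarrow> v \<in> operated_words X \<Longrightarrow> u @ v \<in> operated_words X"
  by (auto simp: operated_words_eq)

lemma single_homogeneous:
  "w \<in> operated_words X \<Longrightarrow> oword_parity par w = i \<Longrightarrow> Poly_Mapping.single w a \<in> homogeneous X par i"
  by (simp add: homogeneous_def)

lemma mult_in_homogeneous:
  assumes "f \<in> homogeneous X par i" "g \<in> homogeneous X par j"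
  shows "oas_mult f g \<in> homogeneous X par (i + j)"
  unfolding oas_mult_def
proof (intro oas.subspace_sum[OF subspace_homogeneous] single_homogeneous)
  fix u v assume "u \<in> support f" "v \<in> support g"
  then have "u \<in> operated_words X" "v \<in> operated_words X" "oword_parity par u = i" "oword_parity par v = j"
    using assms by (auto simp: homogeneous_def)
  then show "u @ v \<in> operated_words X" "oword_parity par (u @ v) = i + j"
    by (auto simp: word_parity_def operated_words_append)
qed

lemma op_homogeneous:
  assumes "f \<in> homogeneous X par i"
  shows "oas_op f \<in> homogeneous X par i"
  unfolding oas_op_def
proof (intro oas.subspace_sum[OF subspace_homogeneous] single_homogeneous)
  fix w assume "w \<in> support f"
  then have "w \<in> operated_words X" "oword_parity par w = i" using assms by (auto simp: homogeneous_def)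
  then show "[OpLetter w] \<in> operated_words X" "oword_parity par [OpLetter w] = i"
    by (auto simp: word_parity_def operated_words_eq)
qed

lemma OAS_simps [simp]:
  "scl (OAS_Lie X par) = oas_scale" "hom (OAS_Lie X par) i = homogeneous X par i"
  "mul (OAS_Lie X par) = oas_bracket par" "opr (OAS_Lie X par) = oas_op"
  by (simp_all add: OAS_Lie_def homogeneous_def)

lemma bracket_in_homogeneous:
  assumes "f \<in> homogeneous X par i" "g \<in> homogeneous X par j"
  shows "oas_bracket par f g \<in> homogeneous X par (i + j)"
  unfolding bracket_homogeneous[OF assms]
  using mult_in_homogeneous[OF assms] mult_in_homogeneous[OF assms(2,1)]
  by (intro oas.subspace_diff oas.subspace_scale subspace_homogeneous) (simp_all only: add.commute)

lemma operated_Lie_superalgebra_OAS: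
  "operated_Lie_superalgebra (OAS_Lie X par :: ('k::field, ('x, 'k) oas) operated_superalg)"
proof -
  let ?A = "OAS_Lie X par :: ('k, ('x, 'k) oas) operated_superalg"
  interpret vector_space "scl ?A" using vector_space_oas by simp
  show ?thesis
  proof
    show "subspace (hom ?A i)" for i using subspace_homogeneous by simp
    have "f = 0" if "f \<in> homogeneous X par 0" "f \<in> homogeneous X par 1" for f :: "('x, 'k) oas"
      using component_homogeneous[OF that(1), of 0] component_homogeneous[OF that(2), of 0] by simp
    then show "hom ?A 0 \<inter> hom ?A 1 = {0}"
      using oas.subspace_0[OF subspace_homogeneous, of X par] by auto
    show "mul ?A a b \<in> hom ?A (i + j)" if "a \<in> hom ?A i" "b \<in> hom ?A j" for a b i j
      using that unfolding OAS_simps by (rule bracket_in_homogeneous)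
    show "mul ?A a b = - scl ?A (koszul i j) (mul ?A b a)"
      if "a \<in> hom ?A i" "b \<in> hom ?A j" for a b i j
      using that by (cases i; cases j) (simp_all add: bracket_homogeneous koszul_def)
    show "mul ?A a (mul ?A b d) = mul ?A (mul ?A a b) d + scl ?A (koszul i j) (mul ?A b (mul ?A a d))"
      if "a \<in> hom ?A i" "b \<in> hom ?A j" "d \<in> hom ?A l" for a b d i j l
    proof -
      have h: "a \<in> homogeneous X par i" "b \<in> homogeneous X par j" "d \<in> homogeneous X par l"
        using that by simp_all
      show ?thesis
        unfolding OAS_simps
          bracket_homogeneous[OF h(1) bracket_in_homogeneous[OF h(2,3)]]
          bracket_homogeneous[OF bracket_in_homogeneous[OF h(1,2)] h(3)]
          bracket_homogeneous[OF h(2) bracket_in_homogeneous[OF h(1,3)]]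
        unfolding bracket_homogeneous[OF h(2,3)] bracket_homogeneous[OF h(1,2)] bracket_homogeneous[OF h(1,3)]
        by (cases i; cases j; cases l)
          (simp_all add: koszul_def oas_mult_diff_left oas_mult_diff_right oas_mult_add_left oas_mult_add_right
            oas_mult_minus_left oas_mult_minus_right oas_mult_assoc)
    qed
  qed (simp_all add: bracket_add_left bracket_add_right bracket_scale_left bracket_scale_right
      op_homogeneous oas_op_add oas_op_scale)
qed

lemma interp_eval: "interp par m = eval_omonomial (OAS_Lie X par) oas_gen m"
  by (induction m) auto

lemma even_map_oas_gen: "even_map X par (OAS_Lie X par) oas_gen"
  by (auto simp: even_map_def oas_gen_def word_parity_def operated_words_eq intro!: single_homogeneous)

lemma operated_evaluation_OAS:
  "well_order_on X r \<Longrightarrow>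
    operated_evaluation (OAS_Lie X par :: ('k::field_char_0, ('x, 'k) oas) operated_superalg) X r par oas_gen"
  using operated_Lie_superalgebra_OAS even_map_oas_gen
  by (auto simp: operated_evaluation_def operated_evaluation_axioms_def)

section \<open>Leading words\<close>

text \<open>If all words of \<open>f\<close> have the length of \<open>u\<close>, then \<open>uv\<close> can only be obtained as the product of \<open>u\<close> and \<open>v\<close>.\<close>

lemma coeff_mult:
  assumes "\<And>x. x \<in> support f \<Longrightarrow> length x = length u"
  shows "coeff (oas_mult f g) (u @ v) = coeff f u * coeff g v"
proof -
  have inner: "(\<Sum>y\<in>support g. coeff (Poly_Mapping.single (x @ y) (coeff f x * coeff g y)) (u @ v)) =
      (if x = u then coeff f u * coeff g v else 0)" if "x \<in> support f" for x
  proof -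
    have "coeff (Poly_Mapping.single (x @ y) (coeff f x * coeff g y)) (u @ v) =
        (if y = v then if x = u then coeff f u * coeff g v else 0 else 0)" for y
      using assms[OF that] by (auto simp: lookup_single when_def)
    then show ?thesis by (auto simp: sum.delta in_keys_iff)
  qed
  show ?thesis
    unfolding oas_mult_def lookup_sum
    by (simp add: inner cong: sum.cong) (auto simp: sum.delta in_keys_iff)
qed

lemma support_mult: "w \<in> support (oas_mult f g) \<Longrightarrow> \<exists>u\<in>support f. \<exists>v\<in>support g. w = u @ v"
proof (rule ccontr)
  assume w: "w \<in> support (oas_mult f g)" and no: "\<not> (\<exists>u\<in>support f. \<exists>v\<in>support g. w = u @ v)"
  have "coeff (oas_mult f g) w = 0"
    unfolding oas_mult_def lookup_sum
    by (rule sum.neutral, intro ballI sum.neutral) (use no in \<open>auto simp: lookup_single when_def\<close>)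
  then show False using w by (simp add: in_keys_iff)
qed

locale oprime_alphabet = alphabet "prime_gt r" Y for r :: "'x rel" and Y :: "'x oprime set"
begin

notation lex_less (infix "\<prec>" 50)

text \<open>All words in the support share the length and the degree of \<open>u\<close>, so that there
\<open>u \<prec> w\<close> is the same as \<open>u >\<^sub>D\<^sub>l w\<close>. Equal lengths make \<open>\<prec>\<close> compatible with concatenation, and equal
degrees make it compatible with the operator.\<close>

definition leading :: "'x oprime list \<Rightarrow> ('x, 'k::field) oas \<Rightarrow> bool" where
  "leading u f \<longleftrightarrow> coeff f u \<noteq> 0 \<and>
    (\<forall>w\<in>support f. length w = length u \<and> Deg w = Deg u \<and> (w = u \<or> u \<prec> w))"

lemma leading_coeff: "leading u f \<Longrightarrow> coeff f u \<noteq> 0"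
  unfolding leading_def by blast

lemma leading_mult:
  assumes "leading u f" "leading v g"
  shows "leading (u @ v) (oas_mult f g)"
  unfolding leading_def
proof (intro conjI ballI)
  show "coeff (oas_mult f g) (u @ v) \<noteq> 0"
    using leading_coeff[OF assms(1)] leading_coeff[OF assms(2)] assms(1)
    by (subst coeff_mult) (simp_all add: leading_def)
  fix w assume "w \<in> support (oas_mult f g)"
  then obtain x y where w: "w = x @ y" "x \<in> support f" "y \<in> support g" using support_mult by blast
  then have x: "length x = length u" "Deg x = Deg u" "x = u \<or> u \<prec> x"
    and y: "length y = length v" "Deg y = Deg v" "y = v \<or> v \<prec> y"
    using assms unfolding leading_def by blast+
  show "length w = length (u @ v)" using w x y by simp
  show "Deg w = Deg (u @ v)" using w x y by (simp add: Deg_def)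
  show "w = u @ v \<or> u @ v \<prec> w"
    using x(3)
  proof
    assume "x = u"
    then show ?thesis using y(3) w by auto
  next
    assume "u \<prec> x"
    then show ?thesis using less_append_append_length[of u x v y] x(1) w(1) by simp
  qed
qed

lemma leading_scale:
  assumes "c \<noteq> 0" "leading u f"
  shows "leading u (oas_scale c f)"
proof -
  have "support (oas_scale c f) = support f" using assms(1) by (auto simp: in_keys_iff)
  moreover have "coeff (oas_scale c f) u \<noteq> 0" using assms(1) leading_coeff[OF assms(2)] by simp
  ultimately show ?thesis using assms(2) unfolding leading_def by metis
qed

lemma leading_diff:
  assumes "leading u f" "leading v g" "u \<prec> v" "length u = length v" "Deg u = Deg v"
  shows "leading u (f - g)"
  unfolding leading_def
proof (intro conjI ballI)
  have "u \<notin> support g"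
  proof
    assume "u \<in> support g"
    then have "u = v \<or> v \<prec> u" using assms(2) unfolding leading_def by blast
    then show False using assms(3) less_trans[of u v u] by auto
  qed
  then show "coeff (f - g) u \<noteq> 0"
    using leading_coeff[OF assms(1)] by (simp add: lookup_minus in_keys_iff)
  fix w assume "w \<in> support (f - g)"
  then consider "w \<in> support f" | "w \<in> support g" by (fastforce simp: in_keys_iff lookup_minus)
  then have "length w = length u \<and> Deg w = Deg u \<and> (w = u \<or> u \<prec> w)"
  proof cases
    case 1
    then show ?thesis using assms(1) unfolding leading_def by blast
  next
    case 2
    then have "length w = length v" "Deg w = Deg v" "w = v \<or> v \<prec> w"
      using assms(2) unfolding leading_def by blast+
    then show ?thesis using assms(3-5) less_trans[of u v w] by auto
  qed
  then show "length w = length u" "Deg w = Deg u" "w = u \<or> u \<prec> w" by blast+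
qed

lemma leading_op:
  assumes "leading u f"
  shows "leading [OpLetter u] (oas_op f)"
  unfolding leading_def
proof (intro conjI ballI)
  show "coeff (oas_op f) [OpLetter u] \<noteq> 0" using leading_coeff[OF assms] by (simp add: coeff_op)
  fix v assume "v \<in> support (oas_op f)"
  then obtain w where w: "v = [OpLetter w]" "w \<in> support f"
    by (auto simp: in_keys_iff coeff_op split: list.splits oprime.splits)
  then have "length w = length u" "Deg w = Deg u" "w = u \<or> u \<prec> w"
    using assms unfolding leading_def by blast+
  then show "length v = length [OpLetter u]" "Deg v = Deg [OpLetter u]" "v = [OpLetter u] \<or> [OpLetter u] \<prec> v"
    using w by (auto simp: Deg_def prime_gt.simps Dl_gt.simps)
qed

lemma leading_Dl_gt:
  assumes "leading u f" "w \<in> support f" "w \<noteq> u"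
  shows "Dl_gt r u w"
  using assms unfolding leading_def Dl_gt.simps by auto

end

locale OAS_letters =
  oprime_alphabet r Y +
  Lie_superalgebra_letters "OAS_Lie X par :: ('k::field_char_0, ('x, 'k) oas) operated_superalg"
    "prime_gt r" Y "prime_parity par" e
  for r :: "'x rel" and Y :: "'x oprime set" and X :: "'x set" and par :: "'x \<Rightarrow> bit"
    and e :: "'x oprime \<Rightarrow> ('x, 'k::field_char_0) oas" +
  assumes letter_leading: "p \<in> Y \<Longrightarrow> leading [p] (e p)"
begin

text \<open>For the standard factorization \<open>u = vw\<close> the two terms of \<open>[[v],[w]]\<close> have leading words \<open>vw\<close> and \<open>wv\<close>,
and \<open>vw \<prec> wv\<close> because \<open>u\<close> is an LS word. So the second term does not disturb the first.\<close>

lemma LS_leading: "u \<in> LS \<Longrightarrow> leading u (monomial u)"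
proof (induction u rule: length_induct)
  case (1 u)
  show ?case
  proof (cases "1 < length u")
    case False
    then obtain p where "u = [p]" using LS_nonempty[OF 1(2)] by (cases u) auto
    then show ?thesis using letter_leading 1(2) by (simp add: monomial_letter LS_def)
  next
    case True
    then obtain v w where vw: "u = v @ w" "v = take (LS_split (prime_gt r) u) u"
      "v \<in> LS" "w \<in> LS" "v \<noteq> []" "w \<noteq> []"
      using 1(2) LS_split_factors[of u] unfolding LS_def by blast
    have "LS_split (prime_gt r) u = length v"
      using LS_split_bounds(2)[of u "prime_gt r"] True vw(2) by simp
    then have "monomial u = oas_bracket par (monomial v) (monomial w)"
      using monomial_standard[of v w] 1(2) True vw(1) by simp
    also have "\<dots> = oas_mult (monomial v) (monomial w) -
        oas_scale (koszul (oword_parity par v) (oword_parity par w)) (oas_mult (monomial w) (monomial v))"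
      using LS_hom[OF vw(3)] LS_hom[OF vw(4)] by (intro bracket_homogeneous) simp_all
    finally have eq: "monomial u = \<dots>" .
    have "length v < length u" "length w < length u"
      using arg_cong[OF vw(1), of length] vw(5,6) by simp_all
    then have lead: "leading v (monomial v)" "leading w (monomial w)"
      using 1(1) vw(3,4) by blast+
    have "LS_word (prime_gt r) (v @ w)" using 1(2) unfolding vw(1) by (simp add: LS_def)
    then have rot: "v @ w \<prec> w @ v" unfolding LS_word_def using vw(5,6) by blast
    show ?thesis
      unfolding eq unfolding vw(1)
    proof (rule leading_diff[OF leading_mult[OF lead] leading_scale[OF _ leading_mult[OF lead(2,1)]] rot])
      show "koszul (oword_parity par v) (oword_parity par w) \<noteq> (0 :: 'k)" by (simp add: koszul_def)
    qed (simp_all add: Deg_def)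
  qed
qed

text \<open>The bracket of an odd element with itself is twice its square, and two is invertible.\<close>

lemma SLS_leading:
  assumes "u \<in> SLS_words (prime_gt r) (prime_parity par) Y"
  shows "leading u (monomial u)"
proof (cases "LS_word (prime_gt r) u")
  case True
  then show ?thesis using assms LS_leading by (auto simp: SLS_words_def LS_def)
next
  case False
  then obtain v where v: "LS_word (prime_gt r) v" "oword_parity par v = 1" "u = v @ v"
    using assms unfolding SLS_words_def by blast
  then have vLS: "v \<in> LS" using assms by (auto simp: SLS_words_def LS_def)
  have hom: "monomial v \<in> homogeneous X par 1" using LS_hom[OF vLS] v(2) by simp
  have "monomial u = oas_bracket par (monomial v) (monomial v)"
    using monomial_square[OF LS_nonempty[OF vLS]] v(3) by simp
  also have "\<dots> = oas_scale 2 (oas_mult (monomial v) (monomial v))"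
    using bracket_homogeneous[OF hom hom] oas.scale_left_distrib[of 1 1 "oas_mult (monomial v) (monomial v)"]
    by (simp add: koszul_def)
  finally show ?thesis
    unfolding v(3) using leading_scale[OF _ leading_mult[OF LS_leading LS_leading]] vLS by simp
qed

end

text \<open>By induction on the depth: leading words of the letters pass to leading words of SLS monomials in them,
and these pass through the operator to the letters of the next depth.\<close>

lemma leading_interp:
  assumes wo: "well_order_on X r" and u: "u \<in> OSLSW r par X"
  shows "coeff (interp par (bracketing r u) :: ('x, 'k::field_char_0) oas) u \<noteq> 0"
    and "w \<in> support (interp par (bracketing r u) :: ('x, 'k) oas) \<Longrightarrow> w \<noteq> u \<Longrightarrow> Dl_gt r u w"
proof -
  let ?A = "OAS_Lie X par :: ('k, ('x, 'k) oas) operated_superalg"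
  interpret operated_evaluation ?A X r par oas_gen using operated_evaluation_OAS[OF wo] .
  let ?e = "\<lambda>p. eval (prime_bracketing r p)"
  interpret P: oprime_alphabet r "operated_primes X"
    using alphabet_primes[OF wo] by (simp add: oprime_alphabet_def)

  have lettersn: "OAS_letters r (OSLS_letters r par X n) X par ?e"
    if "\<And>p. p \<in> OSLS_letters r par X n \<Longrightarrow> P.leading [p] (?e p)" for n
  proof -
    interpret Lie_superalgebra_letters ?A "prime_gt r" "OSLS_letters r par X n" "prime_parity par" ?e
      by (rule letters)
    interpret oprime_alphabet r "OSLS_letters r par X n" ..
    show ?thesis by unfold_locales (rule that)
  qed
  have SLS: "P.leading w (eval (bracketing r w))"
    if "OAS_letters r (OSLS_letters r par X n) X par ?e" "w \<in> OSLSW_upto r par X n" for w n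
    using OAS_letters.SLS_leading[OF that(1)] that(2) eval_bracketing SLS_words_nonempty
    unfolding OSLSW_upto_def by metis
  have single: "P.leading [Letter x] (?e (Letter x))" for x
    by (simp add: P.leading_def oas_gen_def)
  have "P.leading [p] (?e p)" if "p \<in> OSLS_letters r par X n" for p n
    using that
  proof (induction n arbitrary: p)
    case 0
    then show ?case using single by auto
  next
    case (Suc n)
    have "P.leading [OpLetter w] (eval (prime_bracketing r (OpLetter w)))"
      if "w \<in> OSLSW_upto r par X n" for w
      using P.leading_op[OF SLS[OF lettersn[OF Suc.IH] that]] by simp
    then show ?case using Suc.prems single unfolding OSLSW_upto_def OSLS_letters.simps by blast
  qed
  then have "P.leading u (eval (bracketing r u))"
    using SLS lettersn u unfolding OSLSW_def by blast
  then have "P.leading u (interp par (bracketing r u) :: ('x, 'k) oas)" by (simp only: interp_eval[of par _ X])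
  then show "coeff (interp par (bracketing r u) :: ('x, 'k) oas) u \<noteq> 0"
    "w \<in> support (interp par (bracketing r u) :: ('x, 'k) oas) \<Longrightarrow> w \<noteq> u \<Longrightarrow> Dl_gt r u w"
    using P.leading_Dl_gt P.leading_coeff by blast+
qed

section \<open>Linear independence\<close>

text \<open>Among the words \<open>u\<close> with \<open>c u \<noteq> 0\<close> choose a maximal one; it does not occur in the elements that belong
to the others, so its coefficient in the sum does not vanish.\<close>

lemma triangular_combination_zero:
  fixes f :: "'x oprime list \<Rightarrow> ('x, 'k::field) oas"
  assumes R: "transp R" "irreflp R"
    and lead: "\<And>u. u \<in> U \<Longrightarrow> coeff (f u) u \<noteq> 0"
    and smaller: "\<And>u w. u \<in> U \<Longrightarrow> w \<in> support (f u) \<Longrightarrow> w \<noteq> u \<Longrightarrow> R u w"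
    and T: "finite T" "T \<subseteq> U" and zero: "(\<Sum>u\<in>T. oas_scale (c u) (f u)) = 0"
  shows "\<forall>u\<in>T. c u = 0"
proof (rule ccontr)
  define S where "S = {u \<in> T. c u \<noteq> 0}"
  assume "\<not> (\<forall>u\<in>T. c u = 0)"
  then have S: "S \<noteq> {}" "finite S" using T by (auto simp: S_def)
  have "asymp_on S R" "transp_on S R"
    using R by (meson asymp_on_subset asymp_on_iff_irreflp_on_if_transp_on subset_UNIV, meson transp_on_subset subset_UNIV)
  \<comment> \<open>\<open>R u w\<close> says that \<open>u\<close> is the greater word, so that maximal words are minimal for \<open>R\<close>.\<close>
  then obtain m where m: "m \<in> S" "\<And>u. u \<in> S \<Longrightarrow> u \<noteq> m \<Longrightarrow> \<not> R u m"
    using Finite_Set.bex_min_element[OF S(2) _ _ S(1), of R] by blast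
  have mT: "m \<in> T" using m(1) by (simp add: S_def)
  have "c u * coeff (f u) m = (if u = m then c m * coeff (f m) m else 0)" if "u \<in> T" for u
  proof (cases "u = m \<or> c u = 0")
    case False
    then have "\<not> R u m" using that m(2) by (simp add: S_def)
    then have "m \<notin> support (f u)" using smaller[of u m] that T(2) False by blast
    then show ?thesis using False by (simp add: in_keys_iff)
  qed auto
  then have "coeff (\<Sum>u\<in>T. oas_scale (c u) (f u)) m = (\<Sum>u\<in>T. if u = m then c m * coeff (f m) m else 0)"
    by (simp add: lookup_sum)
  also have "\<dots> = c m * coeff (f m) m" using mT T(1) by simp
  finally have "c m * coeff (f m) m = 0" using zero by simp
  then show False using m(1) lead[of m] T(2) by (auto simp: S_def)
qed

lemma Dl_gt_transp:
  assumes "well_order_on X r"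
  shows "transp (Dl_gt r)"
proof (rule transpI)
  interpret alphabet "prime_gt r" "operated_primes X" using alphabet_primes[OF assms] by simp
  fix u v w assume "Dl_gt r u v" "Dl_gt r v w"
  then show "Dl_gt r u w"
    using less_trans[of u v w] by (auto simp: Dl_gt.simps)
qed

lemma Dl_gt_irreflp: "irreflp (Dl_gt r)"
proof (rule irreflpI)
  show "\<not> Dl_gt r u u" for u
    using lex_gt_irrefl[of u "prime_gt r"] prime_gt_irrefl[of r] by (simp add: Dl_gt.simps)
qed

lemma OSLSM_combination_zero:
  fixes c :: "'x oprime list \<Rightarrow> 'k::field_char_0"
  assumes wo: "well_order_on X r" and T: "finite T" "T \<subseteq> OSLSW r par X"
    and zero: "(\<Sum>u\<in>T. oas_scale (c u) (interp par (bracketing r u))) = 0"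
  shows "\<forall>u\<in>T. c u = 0"
proof (rule triangular_combination_zero[OF Dl_gt_transp[OF wo] Dl_gt_irreflp _ _ T zero])
  show "coeff (interp par (bracketing r u) :: ('x, 'k) oas) u \<noteq> 0" if "u \<in> OSLSW r par X" for u
    by (rule leading_interp(1)[OF wo that])
  show "Dl_gt r u w" if "u \<in> OSLSW r par X"
    "w \<in> support (interp par (bracketing r u) :: ('x, 'k) oas)" "w \<noteq> u" for u w
    by (rule leading_interp(2)[OF wo that])
qed

lemma inj_on_interp_bracketing:
  assumes wo: "well_order_on X r"
  shows "inj_on (\<lambda>u. interp par (bracketing r u) :: ('x, 'k::field_char_0) oas) (OSLSW r par X)"
proof (rule inj_onI, rule ccontr)
  fix u v assume uv: "u \<in> OSLSW r par X" "v \<in> OSLSW r par X" "u \<noteq> v"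
    and eq: "interp par (bracketing r u) = (interp par (bracketing r v) :: ('x, 'k) oas)"
  define c where "c w = (if w = u then 1 else - 1 :: 'k)" for w
  have "(\<Sum>w\<in>{u, v}. oas_scale (c w) (interp par (bracketing r w))) = (0 :: ('x, 'k) oas)"
    using uv(3) eq by (simp add: c_def)
  then have "\<forall>w\<in>{u, v}. c w = 0" using uv by (intro OSLSM_combination_zero[OF wo]) auto
  then show False by (simp add: c_def)
qed

lemma independent_OSLSM:
  assumes wo: "well_order_on X r"
  shows "oas.independent (interp par ` OSLSM r par X :: ('x, 'k::field_char_0) oas set)"
  unfolding oas.independent_explicit_module
proof (intro allI impI)
  fix t v and c :: "('x, 'k) oas \<Rightarrow> 'k"
  assume t: "finite t" "t \<subseteq> interp par ` OSLSM r par X" "(\<Sum>v\<in>t. oas_scale (c v) v) = 0" "v \<in> t"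
  let ?f = "\<lambda>u. interp par (bracketing r u) :: ('x, 'k) oas"
  have "t \<subseteq> ?f ` OSLSW r par X" using t(2) by (simp add: OSLSM_def image_image)
  from iffD1[OF subset_image_inj this]
  obtain T where T: "T \<subseteq> OSLSW r par X" "inj_on ?f T" "t = ?f ` T" by blast
  then have "finite T" using t(1) finite_imageD by blast
  moreover have "(\<Sum>u\<in>T. oas_scale (c (?f u)) (?f u)) = 0" using t(3) T by (simp add: sum.reindex)
  ultimately have "\<forall>u\<in>T. c (?f u) = 0" using T(1) by (intro OSLSM_combination_zero[OF wo])
  then show "c v = 0" using t(4) T(3) by auto
qed

section \<open>The generated subalgebra\<close>

context operated_Lie_superalgebra
begin

lemma restrict_simps [simp]:
  "scl (restrict_to A S) = scl A" "mul (restrict_to A S) = mul A" "opr (restrict_to A S) = opr A"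
  "hom (restrict_to A S) i = hom A i \<inter> S"
  by (simp_all add: restrict_to_def)

lemma operated_Lie_superalgebra_restrict:
  assumes "operated_super_subalgebra A S"
  shows "operated_Lie_superalgebra (restrict_to A S)"
proof -
  let ?B = "restrict_to A S"
  have S: "subspace S" "carr ?B = S" "\<And>a b. a \<in> S \<Longrightarrow> b \<in> S \<Longrightarrow> mul A a b \<in> S"
    "\<And>a. a \<in> S \<Longrightarrow> opr A a \<in> S"
    using assms by (auto simp: operated_super_subalgebra_def)
  have "carr ?B \<subseteq> carr A" unfolding carr_def by auto
  then have carr: "a \<in> carr A" if "a \<in> S" for a using that S(2) by blast
  interpret B: vector_space "scl ?B" using vector_space_axioms by simp
  show ?thesis
  proof
    show "B.subspace (hom ?B i)" for i using subspace_inter[OF subspace_hom S(1)] by simp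
    show "hom ?B 0 \<inter> hom ?B 1 = {0}" using hom_direct subspace_0[OF S(1)] by auto
    show "mul ?B a b \<in> hom ?B (i + j)" if "a \<in> hom ?B i" "b \<in> hom ?B j" for a b i j
      using that mul_hom[of a i b j] S(3) unfolding restrict_simps by blast
    show "opr ?B a \<in> hom ?B i" if "a \<in> hom ?B i" for a i
      using that opr_hom S(4) by simp
    show "mul ?B a b = - scl ?B (koszul i j) (mul ?B b a)" if "a \<in> hom ?B i" "b \<in> hom ?B j" for a b i j
      using that skew[of a i b j] unfolding restrict_simps by blast
    show "mul ?B a (mul ?B b d) = mul ?B (mul ?B a b) d + scl ?B (koszul i j) (mul ?B b (mul ?B a d))"
      if "a \<in> hom ?B i" "b \<in> hom ?B j" "d \<in> hom ?B l" for a b d i j l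
      using that jacobi[of a i b j d l] unfolding restrict_simps by blast
  qed (simp_all add: S(2) carr mul_add_left mul_add_right mul_scl_left mul_scl_right opr_add opr_scl)
qed

text \<open>A subspace spanned by homogeneous elements is graded.\<close>

lemma carr_restrict_span:
  assumes "\<And>b. b \<in> B \<Longrightarrow> \<exists>i. b \<in> hom A i"
  shows "carr (restrict_to A (span B)) = span B"
proof
  show "carr (restrict_to A (span B)) \<subseteq> span B"
    unfolding carr_def using span_add by auto
  have "subspace (carr (restrict_to A (span B)))"
    unfolding carr_def restrict_simps
    by (intro subspace_sums subspace_inter subspace_hom subspace_span)
  moreover have "B \<subseteq> carr (restrict_to A (span B))"
  proof
    fix b assume b: "b \<in> B"
    then obtain i where i: "b \<in> hom A i" using assms by blast
    have "b \<in> span B" using b span_base by blast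
    then show "b \<in> carr (restrict_to A (span B))"
    proof (cases i)
      case zero
      then have "b = b + 0 \<and> b \<in> hom A 0 \<inter> span B \<and> 0 \<in> hom A 1 \<inter> span B"
        using i \<open>b \<in> span B\<close> span_zero by simp
      then show ?thesis unfolding carr_def restrict_simps by blast
    next
      case one
      then have "b = 0 + b \<and> 0 \<in> hom A 0 \<inter> span B \<and> b \<in> hom A 1 \<inter> span B"
        using i \<open>b \<in> span B\<close> span_zero by simp
      then show ?thesis unfolding carr_def restrict_simps by blast
    qed
  qed
  ultimately show "span B \<subseteq> carr (restrict_to A (span B))" by (simp add: span_minimal)
qed

text \<open>Combinations are indexed by \<open>U\<close> rather than by the vectors \<open>g u\<close>, so that the same coefficients can be
read in both factors of a product.\<close>

lemma span_image_combination:
  assumes "x \<in> span (g ` U)"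
  obtains T c where "finite T" "T \<subseteq> U" "x = (\<Sum>u\<in>T. scl A (c u) (g u))"
proof -
  obtain t c where t: "finite t" "t \<subseteq> g ` U" "x = (\<Sum>v\<in>t. scl A (c v) v)"
    using assms unfolding span_explicit by blast
  obtain T where T: "T \<subseteq> U" "inj_on g T" "t = g ` T"
    using iffD1[OF subset_image_inj t(2)] by blast
  then have "finite T" using t(1) finite_imageD by blast
  moreover have "x = (\<Sum>u\<in>T. scl A (c (g u)) (g u))"
    using t(3) T by (simp add: sum.reindex)
  ultimately show ?thesis using that[of T "\<lambda>u. c (g u)"] T(1) by blast
qed

end

lemma eval_omonomial_restrict: "eval_omonomial (restrict_to A S) j m = eval_omonomial A j m"
  by (induction m) (simp_all add: restrict_to_def)

context operated_evaluation
begin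

lemma OSLSM_super_subalgebra: "operated_super_subalgebra A OSLSM_span"
  unfolding operated_super_subalgebra_def
  using subspace_OSLSM_span OSLSM_span_mul OSLSM_span_opr
    carr_restrict_span[OF OSLSM_hom] by (auto simp: OSLSM_span_def)

text \<open>The span is an operated subalgebra by the rewriting argument, and each subalgebra that contains the
generators contains the values of all monomials.\<close>

lemma hull_eq_OSLSM_span: "operated_super_subalgebra A hull (j ` X) = OSLSM_span"
proof (rule hull_unique)
  show "j ` X \<subseteq> OSLSM_span" using OSLSM_span_letter by blast
  show "operated_super_subalgebra A OSLSM_span" by (rule OSLSM_super_subalgebra)
  fix T assume gen: "j ` X \<subseteq> T" and "operated_super_subalgebra A T"
  then have T: "subspace T" "\<And>a b. a \<in> T \<Longrightarrow> b \<in> T \<Longrightarrow> mul A a b \<in> T" "\<And>a. a \<in> T \<Longrightarrow> opr A a \<in> T"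
    by (auto simp: operated_super_subalgebra_def)
  have "eval m \<in> T" if "set_omonomial m \<subseteq> X" for m
    using that by (induction m) (use gen T in auto)
  then have "eval ` OSLSM r par X \<subseteq> T"
    using set_bracketing OSLSW_lists unfolding OSLSM_def by blast
  then show "OSLSM_span \<subseteq> T" unfolding OSLSM_span_def using T(1) by (rule span_minimal)
qed

end

section \<open>Freeness\<close>

definition prod_superalg ::
  "('k, 'v) operated_superalg \<Rightarrow> ('k, 'w) operated_superalg \<Rightarrow> ('k, 'v \<times> 'w) operated_superalg" where
  "prod_superalg A B =
    \<lparr>scl = \<lambda>c z. (scl A c (fst z), scl B c (snd z)),
     hom = \<lambda>i. hom A i \<times> hom B i,
     mul = \<lambda>y z. (mul A (fst y) (fst z), mul B (snd y) (snd z)),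
     opr = \<lambda>z. (opr A (fst z), opr B (snd z))\<rparr>"

lemma prod_superalg_simps [simp]:
  "scl (prod_superalg A B) c z = (scl A c (fst z), scl B c (snd z))"
  "hom (prod_superalg A B) i = hom A i \<times> hom B i"
  "mul (prod_superalg A B) y z = (mul A (fst y) (fst z), mul B (snd y) (snd z))"
  "opr (prod_superalg A B) z = (opr A (fst z), opr B (snd z))"
  by (simp_all add: prod_superalg_def)

lemma eval_omonomial_prod:
  "eval_omonomial (prod_superalg A B) (\<lambda>x. (i x, j x)) m = (eval_omonomial A i m, eval_omonomial B j m)"
  by (induction m) simp_all

lemma carr_prod: "carr (prod_superalg A B) = carr A \<times> carr B"
  by (force simp: carr_def)

lemma operated_Lie_superalgebra_prod:
  fixes A :: "('k::field, 'v::ab_group_add) operated_superalg"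
    and B :: "('k, 'w::ab_group_add) operated_superalg"
  assumes "operated_Lie_superalgebra A" "operated_Lie_superalgebra B"
  shows "operated_Lie_superalgebra (prod_superalg A B)"
proof -
  interpret A: operated_Lie_superalgebra A by fact
  interpret B: operated_Lie_superalgebra B by fact
  let ?P = "prod_superalg A B"
  interpret P: vector_space "scl ?P"
    by unfold_locales (auto simp: A.scale_right_distrib A.scale_left_distrib
        B.scale_right_distrib B.scale_left_distrib)
  show ?thesis
  proof
    show "P.subspace (hom ?P i)" for i
      using A.subspace_hom[of i] B.subspace_hom[of i]
      by (auto simp: P.subspace_def A.subspace_def B.subspace_def zero_prod_def)
    show "hom ?P 0 \<inter> hom ?P 1 = {0}" using A.hom_direct B.hom_direct by (auto simp: zero_prod_def)
    show "mul ?P a b \<in> hom ?P (i + j)" if "a \<in> hom ?P i" "b \<in> hom ?P j" for a b i j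
      using that A.mul_hom B.mul_hom unfolding prod_superalg_simps by (auto simp only: mem_Times_iff fst_conv snd_conv)
    show "mul ?P a b = - scl ?P (koszul i j) (mul ?P b a)" if "a \<in> hom ?P i" "b \<in> hom ?P j" for a b i j
      using that A.skew[of "fst a" i "fst b" j] B.skew[of "snd a" i "snd b" j] by auto
    show "mul ?P a (mul ?P b d) = mul ?P (mul ?P a b) d + scl ?P (koszul i j) (mul ?P b (mul ?P a d))"
      if "a \<in> hom ?P i" "b \<in> hom ?P j" "d \<in> hom ?P l" for a b d i j l
      using that A.jacobi[of "fst a" i "fst b" j "fst d" l] B.jacobi[of "snd a" i "snd b" j "snd d" l] by auto
  qed (auto simp: carr_prod A.mul_add_left B.mul_add_left A.mul_add_right B.mul_add_right
      A.mul_scl_left B.mul_scl_left A.mul_scl_right B.mul_scl_right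
      A.opr_hom B.opr_hom A.opr_add B.opr_add A.opr_scl B.opr_scl)
qed

text \<open>The homomorphism is given by its graph \<open>G\<close>, the subalgebra of \<open>OAS(X) \<times> L\<close> generated by the pairs
\<open>(x, j x)\<close>. It is single valued because a vanishing first component \<open>\<Sum> c\<^sub>u [u]\<close> forces all coefficients to
vanish, and these are also the coefficients of the second component.\<close>

lemma OLS_hom_exists:
  fixes X :: "'x set" and par :: "'x \<Rightarrow> bit" and L :: "('k::field_char_0, 'l::ab_group_add) operated_superalg"
  defines "F \<equiv> OLS X par :: ('k, ('x, 'k) oas) operated_superalg"
  assumes wo: "well_order_on X r"
    and L: "operated_Lie_superalgebra L" and j: "even_map X par L j"
  obtains \<phi> where "\<phi> \<in> extensional (carr F)" "operated_hom F L \<phi>" "\<And>x. x \<in> X \<Longrightarrow> \<phi> (oas_gen x) = j x"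
proof -
  let ?A = "OAS_Lie X par :: ('k, ('x, 'k) oas) operated_superalg"
  let ?P = "prod_superalg ?A L"
  interpret A: operated_evaluation ?A X r par oas_gen using operated_evaluation_OAS[OF wo] .
  interpret L: operated_Lie_superalgebra L by fact
  interpret P: operated_Lie_superalgebra ?P
    using A.operated_Lie_superalgebra_axioms L by (rule operated_Lie_superalgebra_prod)
  interpret P: operated_evaluation ?P X r par "\<lambda>x. (oas_gen x, j x)"
    using wo j A.even by unfold_locales (auto simp: even_map_def)
  define G where "G = P.OSLSM_span"
  define S where "S = A.OSLSM_span"
  have carrF: "carr F = S" "F = restrict_to ?A S"
    using A.OSLSM_super_subalgebra A.hull_eq_OSLSM_span
    by (simp_all add: F_def OLS_def S_def operated_super_subalgebra_def)
  have subG: "P.subspace G" unfolding G_def by (rule P.subspace_OSLSM_span)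
  have G_add: "(a + b, l + m) \<in> G" if "(a, l) \<in> G" "(b, m) \<in> G" for a b l m
    using P.subspace_add[OF subG that] by simp
  have G_scl: "(oas_scale c a, scl L c l) \<in> G" if "(a, l) \<in> G" for c a l
    using P.subspace_scale[OF subG that, of c] by simp
  have G_mul: "(oas_bracket par a b, mul L l m) \<in> G" if "(a, l) \<in> G" "(b, m) \<in> G" for a b l m
    using P.OSLSM_span_mul[of "(a, l)" "(b, m)"] that by (simp add: G_def)
  have G_opr: "(oas_op a, opr L l) \<in> G" if "(a, l) \<in> G" for a l
    using P.OSLSM_span_opr[of "(a, l)"] that by (simp add: G_def)
  have G_span: "G = P.span ((\<lambda>u. P.eval (bracketing r u)) ` OSLSW r par X)"
    by (simp add: G_def P.OSLSM_span_def OSLSM_def image_image)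
  have S_span: "S = A.span ((\<lambda>u. A.eval (bracketing r u)) ` OSLSW r par X)"
    by (simp add: S_def A.OSLSM_span_def OSLSM_def image_image)
  have G_zero: "l = 0" if l: "(0, l) \<in> G" for l
  proof -
    obtain T c where T: "finite T" "T \<subseteq> OSLSW r par X"
      and eq: "(0, l) = (\<Sum>u\<in>T. scl ?P (c u) (P.eval (bracketing r u)))"
      using P.span_image_combination[OF l[unfolded G_span]] by blast
    from arg_cong[OF eq, of fst] have "(\<Sum>u\<in>T. oas_scale (c u) (interp par (bracketing r u))) = 0"
      by (simp add: fst_sum eval_omonomial_prod interp_eval[of par _ X])
    then have "\<forall>u\<in>T. c u = 0" using T by (intro OSLSM_combination_zero[OF wo])
    then show ?thesis using arg_cong[OF eq, of snd] by (simp add: snd_sum)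
  qed
  have unique: "l = m" if "(a, l) \<in> G" "(a, m) \<in> G" for a l m
    using G_zero[of "l - m"] P.subspace_diff[OF subG that] by simp
  have dom: "\<exists>l. (a, l) \<in> G" if "a \<in> S" for a
  proof -
    have "A.subspace {a. \<exists>l. (a, l) \<in> G}"
      using P.subspace_0[OF subG] G_add G_scl by (fastforce simp: oas.subspace_def zero_prod_def)
    moreover have "A.eval (bracketing r u) \<in> {a. \<exists>l. (a, l) \<in> G}" if "u \<in> OSLSW r par X" for u
      using P.OSLSW_in_span[OF that] by (auto simp: G_def eval_omonomial_prod)
    ultimately have "S \<subseteq> {a. \<exists>l. (a, l) \<in> G}"
      unfolding S_span by (intro A.span_minimal) auto
    then show ?thesis using that by blast
  qed
  define \<phi> where "\<phi> = restrict (\<lambda>a. THE l. (a, l) \<in> G) S"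
  have \<phi>_eq: "\<phi> a = l" if "a \<in> S" "(a, l) \<in> G" for a l
    using that unique by (auto simp: \<phi>_def)
  have \<phi>_G: "(a, \<phi> a) \<in> G" if "a \<in> S" for a
    using dom[OF that] \<phi>_eq[OF that] by auto
  have sub: "A.subspace S" unfolding S_def by (rule A.subspace_OSLSM_span)
  have even: "\<phi> a \<in> hom L i" if "a \<in> homogeneous X par i" "a \<in> S" for a i
  proof -
    have "(a, \<phi> a) \<in> carr (restrict_to ?P G)"
      using P.OSLSM_super_subalgebra \<phi>_G[OF that(2)] by (simp add: G_def operated_super_subalgebra_def)
    \<comment> \<open>As \<open>G\<close> is graded, \<open>(a, \<phi> a)\<close> splits inside \<open>G\<close>; for homogeneous \<open>a\<close> one part has first
      component zero, and then its second component vanishes as well.\<close>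
    then obtain a0 a1 l0 l1 where d: "a = a0 + a1" "\<phi> a = l0 + l1" "(a0, l0) \<in> G" "(a1, l1) \<in> G"
      "a0 \<in> homogeneous X par 0" "a1 \<in> homogeneous X par 1" "l0 \<in> hom L 0" "l1 \<in> hom L 1"
      unfolding carr_def by auto
    have int: "f = 0" if "f \<in> homogeneous X par 0" "f \<in> homogeneous X par 1" for f :: "('x, 'k) oas"
      using that A.hom_direct by auto
    show ?thesis
    proof (cases i)
      case zero
      then have "a - a0 \<in> homogeneous X par 0"
        using that(1) d(5) oas.subspace_diff[OF subspace_homogeneous] by blast
      then have "a1 = 0" using int[of a1] d(1,6) by simp
      then show ?thesis using G_zero[of l1] d zero by simp
    next
      case one
      then have "a - a1 \<in> homogeneous X par 1"
        using that(1) d(6) oas.subspace_diff[OF subspace_homogeneous] by blast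
      then have "a0 = 0" using int[of a0] d(1,5) by simp
      then show ?thesis using G_zero[of l0] d one by simp
    qed
  qed
  have "operated_hom F L \<phi>"
    unfolding operated_hom_def carrF(1)
  proof (intro conjI allI ballI)
    show "\<phi> a \<in> hom L i" if "a \<in> hom F i" for i a
      using that even by (simp add: carrF(2))
    show "\<phi> (a + b) = \<phi> a + \<phi> b" if "a \<in> S" "b \<in> S" for a b
      using that by (intro \<phi>_eq G_add \<phi>_G A.subspace_add[OF sub])
    show "\<phi> (scl F c a) = scl L c (\<phi> a)" if "a \<in> S" for c a
      using that A.subspace_scale[OF sub that, of c] by (intro \<phi>_eq) (simp_all add: carrF(2) G_scl \<phi>_G)
    show "\<phi> (mul F a b) = mul L (\<phi> a) (\<phi> b)" if "a \<in> S" "b \<in> S" for a b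
      using that A.OSLSM_span_mul[of a b] by (intro \<phi>_eq) (simp_all add: carrF(2) G_mul \<phi>_G S_def)
    show "\<phi> (opr F a) = opr L (\<phi> a)" if "a \<in> S" for a
      using that A.OSLSM_span_opr[of a] by (intro \<phi>_eq) (simp_all add: carrF(2) G_opr \<phi>_G S_def)
  qed
  moreover have "\<phi> (oas_gen x) = j x" if "x \<in> X" for x
    using A.OSLSM_span_letter[OF that] P.OSLSM_span_letter[OF that]
    by (intro \<phi>_eq) (simp_all add: S_def G_def)
  ultimately show ?thesis using that[of \<phi>] by (simp add: carrF(1) \<phi>_def)
qed

text \<open>A homomorphism is determined on monomials by its values on \<open>X\<close>.\<close>

lemma operated_hom_eval:
  assumes A: "operated_Lie_superalgebra A" and "operated_hom A L \<phi>" and i: "even_map X par A i"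
    and gen: "\<And>x. x \<in> X \<Longrightarrow> \<phi> (i x) = j x" and m: "set_omonomial m \<subseteq> X"
  shows "eval_omonomial A i m \<in> carr A \<and> \<phi> (eval_omonomial A i m) = eval_omonomial L j m"
proof -
  interpret operated_Lie_superalgebra A by fact
  show ?thesis
    using m
  proof (induction m)
    case (MLetter x)
    then show ?case using i gen hom_carr by (auto simp: even_map_def)
  qed (use assms(2) mul_carr opr_carr in \<open>auto simp: operated_hom_def\<close>)
qed

theorem theorem4p4:
  fixes X :: "'x set" and par :: "'x \<Rightarrow> bit" and r :: "'x rel"
  assumes "well_order_on X r"
  shows "free_operated_Lie_superalgebra TYPE('l::ab_group_add) X par
      (OLS X par :: ('k::field_char_0, ('x, 'k) oas) operated_superalg) oas_gen \<and>
    inj_on (interp par :: 'x omonomial \<Rightarrow> ('x, 'k) oas) (OSLSM r par X) \<and>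
    linear_basis_of oas_scale
      (carr (OLS X par :: ('k, ('x, 'k) oas) operated_superalg)) (interp par ` OSLSM r par X)"
proof (intro conjI)
  let ?A = "OAS_Lie X par :: ('k, ('x, 'k) oas) operated_superalg"
  let ?F = "OLS X par :: ('k, ('x, 'k) oas) operated_superalg"
  interpret A: operated_evaluation ?A X r par oas_gen using operated_evaluation_OAS[OF assms] .
  have F: "?F = restrict_to ?A A.OSLSM_span"
    by (simp add: OLS_def A.hull_eq_OSLSM_span)
  have carrF: "carr ?F = A.OSLSM_span"
    using A.OSLSM_super_subalgebra by (simp add: F operated_super_subalgebra_def)
  have Lie: "operated_Lie_superalgebra ?F"
    unfolding F using A.OSLSM_super_subalgebra by (rule A.operated_Lie_superalgebra_restrict)
  have even: "even_map X par ?F oas_gen"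
    using A.even A.OSLSM_span_letter by (simp add: F even_map_def)
  have scl: "scl ?F = oas_scale" by (simp add: F)
  show "free_operated_Lie_superalgebra TYPE('l) X par ?F oas_gen"
    unfolding free_operated_Lie_superalgebra_def
  proof (intro conjI allI impI)
    show "operated_Lie_superalgebra ?F" "even_map X par ?F oas_gen" by (fact Lie even)+
    fix L :: "('k, 'l) operated_superalg" and j
    assume L: "operated_Lie_superalgebra L \<and> even_map X par L j"
    obtain \<phi> where \<phi>: "\<phi> \<in> extensional (carr ?F)" "operated_hom ?F L \<phi>"
      "\<And>x. x \<in> X \<Longrightarrow> \<phi> (oas_gen x) = j x"
      using OLS_hom_exists[OF assms] L by metis
    show "\<exists>!\<phi>. \<phi> \<in> extensional (carr ?F) \<and> operated_hom ?F L \<phi> \<and> (\<forall>x\<in>X. \<phi> (oas_gen x) = j x)"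
    proof (intro ex1I[of _ \<phi>] conjI ballI)
      fix \<psi> assume \<psi>: "\<psi> \<in> extensional (carr ?F) \<and> operated_hom ?F L \<psi> \<and> (\<forall>x\<in>X. \<psi> (oas_gen x) = j x)"
      show "\<psi> = \<phi>"
      proof (rule extensionalityI)
        show "\<psi> \<in> extensional (carr ?F)" "\<phi> \<in> extensional (carr ?F)" using \<psi> \<phi> by blast+
        let ?E = "{a \<in> carr ?F. \<psi> a = \<phi> a}"
        have "\<psi> 0 = \<phi> 0"
        proof -
          interpret L: operated_Lie_superalgebra L using L by blast
          have "0 \<in> carr ?F" unfolding carrF using A.subspace_0[OF A.subspace_OSLSM_span] .
          then have hom_0: "\<theta> 0 = 0" if "operated_hom ?F L \<theta>" for \<theta>
            using that unfolding operated_hom_def by (metis A.scale_zero_left L.scale_zero_left OAS_simps(1) scl)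
          show ?thesis using hom_0[of \<psi>] hom_0[of \<phi>] \<psi> \<phi>(2) by simp
        qed
        then have "A.subspace ?E"
          using \<psi> \<phi>(2) A.subspace_OSLSM_span
          by (auto simp: oas.subspace_def carrF operated_hom_def scl)
        moreover have "interp par ` OSLSM r par X \<subseteq> ?E"
        proof (rule image_subsetI)
          fix m assume "m \<in> OSLSM r par X"
          then have m: "set_omonomial m \<subseteq> X"
            using set_bracketing OSLSW_lists unfolding OSLSM_def by blast
          have "interp par m = eval_omonomial ?F oas_gen m"
            by (simp add: F eval_omonomial_restrict interp_eval[of par _ X])
          then show "interp par m \<in> ?E"
            using operated_hom_eval[OF Lie _ even _ m, of L \<psi> j] operated_hom_eval[OF Lie _ even _ m, of L \<phi> j]
              \<psi> \<phi> by simp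
        qed
        ultimately have "carr ?F \<subseteq> ?E"
          unfolding carrF A.OSLSM_span_def
          by (intro A.span_minimal) (simp_all add: interp_eval[of par _ X])
        then show "\<psi> a = \<phi> a" if "a \<in> carr ?F" for a using that by blast
      qed
    qed (use \<phi> in auto)
  qed
  show "inj_on (interp par :: 'x omonomial \<Rightarrow> ('x, 'k) oas) (OSLSM r par X)"
    using inj_on_interp_bracketing[OF assms, of par]
    unfolding OSLSM_def by (auto simp: inj_on_def)
  have "oas.independent (interp par ` OSLSM r par X :: ('x, 'k) oas set)"
    by (rule independent_OSLSM[OF assms])
  moreover have "interp par ` OSLSM r par X = A.eval ` OSLSM r par X"
    by (simp add: interp_eval[of par _ X])
  ultimately show "linear_basis_of oas_scale (carr ?F) (interp par ` OSLSM r par X)"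
    unfolding linear_basis_of_def
    using carrF by (intro conjI) (simp_all only: A.OSLSM_span_def OAS_simps not_False_eq_True)
qed

end
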